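(* The correspondence $\gamma:\mathbb{R}^{\mathcal{R}}\to\mathbb{R}^E$, $\lambda\mapsto x:=\chi^{X^{\min}}+A\lambda$, generates a bijection between the characteristic vectors $\chi^I\in\mathbb{R}^{\mathcal{R}}$ of the ideals $I$ of the poset of rotations $(\mathcal{R},\lessdot)$ and the characteristic vectors $\chi^X\in\mathbb{R}^E$ of the stable matchings $X\in\mathcal{S}$. Here $A\in\mathbb{R}^{E\times\mathcal{R}}$ is the matrix whose columns are the vectors $\beta^R$, $R\in\mathcal{R}$, where $\beta^R\in\mathbb{R}^E$ takes value $1$ on $R^+$, $-1$ on $R^-$, and $0$ on the remaining edges.
   Context: Setting. $G=(V,E)$ is a finite bipartite graph without multiple edges, with vertex parts $W$ and $F$; the edge joining $w\in W$ and $f\in F$ is denoted $wf$. $E_v$ is the set of edges incident to $v\in V$, and $X_v:=X\cap E_v$ for $X\subseteq E$. Each $w\in W$ has a strict linear order $>_w$ on $E_w$ ($e>_w e'$ means that $e$ is preferred to $e'$) and quota $q(w)=1$; accordingly $C_w(Z)$, for nonempty $Z\subseteq E_w$, is the one-element set formed by the $>_w$-largest element of $Z$, and $C_w(\emptyset)=\emptyset$. Each $f\in F$ has a choice function $C_f:2^{E_f}\to 2^{E_f}$ with $C_f(Z)\subseteq Z$, satisfying for all $Z,Z'\subseteq E_f$: (A1) if $Z\supseteq Z'\supseteq C_f(Z)$ then $C_f(Z')=C_f(Z)$; (A2) if $Z\supseteq Z'$ then $C_f(Z)\cap Z'\subseteq C_f(Z')$; (A3) if $Z\supseteq Z'$ then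 $|C_f(Z)|\ge |C_f(Z')|$. Stability. A matching is an arbitrary subset $X\subseteq E$. A set $Z\subseteq E_v$ is acceptable if $C_v(Z)=Z$; $X\subseteq E$ is acceptable if all $X_v$, $v\in V$, are. For acceptable $Z,Z'\subseteq E_v$, $Z\succeq_v Z'$ means $C_v(Z\cup Z')=Z$. For distinct acceptable matchings $X,Y$, $X\succ_F Y$ (also written $X\succ Y$, or $Y\prec X$) means $X_f\succeq_f Y_f$ for all $f\in F$. An acceptable $X$ is stable if there is no edge $e=wf\in E\setminus X$ with both $e\in C_w(X_w\cup\{e\})$ and $e\in C_f(X_f\cup\{e\})$. $\mathcal{S}$ is the set of stable matchings. It is known that $\mathcal{S}\neq\emptyset$ and $(\mathcal{S},\prec_F)$ is a distributive lattice; its minimal and maximal elements are denoted $X^{\min}$, $X^{\max}$. Active graph and rotations. Let $X\in\mathcal{S}$. For $w\in W$ with $|X_w|=1$, let $x_w$ be the unique edge of $X_w$. If the set of edges $e=wf\in E_w$ with $x_w>_w e$ and $e\in C_f(X_f\cup\{e\})$ is nonempty, its $>_w$-largest element is called $W$-admissible and denoted $a_w$. If $a_w=wf$ and $C_f(X_f\cup\{a_w\})=(X_f\setminus\{e'\})\cup\{a_w\}$ for some $e'\in X_f$, then $e'$ is called $F$-admissible, is denoted $b^w_f$ and said to be associated with $a_w$, and $(a_w,b^w_f)$ is called a tandem passing $f$ (the only other possibility is $C_f(X_f\cup\{a_w\})=X_f\cup\{a_w\}$, when $a_w$ generates no tandem). Let $D(X)$ be the directed graph on $V$ whose edges are the $W$-admissible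 edges directed from $W$ to $F$ and the $F$-admissible edges directed from $F$ to $W$. Cleaning procedure: as long as the current graph has a vertex $w\in W$ with a leaving edge $a_w=(w,f)$ but no entering edge, delete $a_w$, and if $a_w$ has an associated edge $b^w_f$ which occurs in no other tandem passing $f$ in the current graph, delete $b^w_f$ as well; isolated vertices are removed. The final graph $\Gamma(X)$ is the active graph of $X$. In it every $w\in W$ that remains has exactly one entering and one leaving edge, and for every remaining $f\in F$ the tandems passing $f$ partition the set of edges at $f$. Hence $\Gamma(X)$ decomposes uniquely into pairwise edge-disjoint directed cycles (edge-simple, possibly visiting a vertex of $F$ several times) which at each $w\in W$ go from the entering to the leaving edge, and at each visit to $f\in F$ traverse a tandem ($a_w$, then $b^w_f$). These cycles are the rotations generated by $X$; their set is $\mathcal{L}(X)$. For a rotation $L$, $L^+$ is the set of its edges going from $W$ to $F$ and $L^-$ the set of its edges going from $F$ to $W$ (both regarded as subsets of $E$); a rotation is identified by the pair $(L^+,L^-)$. Applying $L\in\mathcal{L}(X)$ to $X$ gives $(X\setminus L^-)\cup L^+$, which is again a stable matching. Poset of rotations. A route from $X_0$ to $X_N$ is a sequence $X_0,X_1,\ldots,X_N$ with $X_0$ stable and $X_i=(X_{i-1}\setminus L_i^-)\cup L_i^+$ for some $L_i\in\mathcal{L}(X_{i-1})$; its set of rotations is $\{L_1,\ldots,L_N\}$. A full route is one from $X^{\min}$ to $X^{\max}$. All full routes have the same set of rotations, denoted $\mathcal{R}$. For $R,R'\in\mathcal{R}$, $R\lessdot R'$ means that in every full route $R$ is applied earlier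 than $R'$; this is a partial order. An ideal of $(\mathcal{R},\lessdot)$ is a subset $I\subseteq\mathcal{R}$ such that $R\lessdot R'$ and $R'\in I$ imply $R\in I$. For a subset $X$ of $E$ (resp. $I$ of $\mathcal{R}$), $\chi^X\in\mathbb{R}^E$ (resp. $\chi^I\in\mathbb{R}^{\mathcal{R}}$) is its characteristic 0,1-vector. *)

theory Defs
  imports Complex_Main "HOL-Library.FuncSet" "HOL-Library.Indicator_Function"
begin

section \<open>Bipartite graphs with preferences and choice functions\<close>

text \<open>The two vertex parts live in separate types, so they are disjoint; an edge \<open>wf\<close> is the
  pair \<open>(w, f)\<close>, so there are no multiple edges. \<open>gt G w e e'\<close> means \<open>e >\<^sub>w e'\<close>.\<close>

type_synonym ('w, 'f) edge = "'w \<times> 'f"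

record ('w, 'f) market =
  WV :: "'w set"
  FV :: "'f set"
  E :: "('w, 'f) edge set"
  gt :: "'w \<Rightarrow> ('w, 'f) edge \<Rightarrow> ('w, 'f) edge \<Rightarrow> bool"
  choiceF :: "'f \<Rightarrow> ('w, 'f) edge set \<Rightarrow> ('w, 'f) edge set"

definition atW :: "('w, 'f) edge set \<Rightarrow> 'w \<Rightarrow> ('w, 'f) edge set" where
  "atW X w = {e \<in> X. fst e = w}"

definition atF :: "('w, 'f) edge set \<Rightarrow> 'f \<Rightarrow> ('w, 'f) edge set" where
  "atF X f = {e \<in> X. snd e = f}"

locale choice_market =
  fixes G :: "('w, 'f) market"
  assumes finite_WV: "finite (WV G)"
    and finite_FV: "finite (FV G)"
    and edges: "E G \<subseteq> WV G \<times> FV G"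
    and gt_irrefl: "w \<in> WV G \<Longrightarrow> irreflp_on (atW (E G) w) (gt G w)"
    and gt_trans: "w \<in> WV G \<Longrightarrow> transp_on (atW (E G) w) (gt G w)"
    and gt_total: "w \<in> WV G \<Longrightarrow> totalp_on (atW (E G) w) (gt G w)"
    and choice_subset: "\<lbrakk>f \<in> FV G; Z \<subseteq> atF (E G) f\<rbrakk> \<Longrightarrow> choiceF G f Z \<subseteq> Z"
    and A1: "\<lbrakk>f \<in> FV G; Z \<subseteq> atF (E G) f; Z' \<subseteq> Z; choiceF G f Z \<subseteq> Z'\<rbrakk>
      \<Longrightarrow> choiceF G f Z' = choiceF G f Z"
    and A2: "\<lbrakk>f \<in> FV G; Z \<subseteq> atF (E G) f; Z' \<subseteq> Z\<rbrakk>
      \<Longrightarrow> choiceF G f Z \<inter> Z' \<subseteq> choiceF G f Z'"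
    and A3: "\<lbrakk>f \<in> FV G; Z \<subseteq> atF (E G) f; Z' \<subseteq> Z\<rbrakk>
      \<Longrightarrow> card (choiceF G f Z') \<le> card (choiceF G f Z)"

text \<open>The set of \<open>>\<^sub>w\<close>-largest elements of \<open>Z\<close>: a singleton if \<open>Z \<subseteq> E\<^sub>w\<close> is nonempty, and empty
  if \<open>Z\<close> is empty.\<close>

definition choiceW :: "('w, 'f) market \<Rightarrow> 'w \<Rightarrow> ('w, 'f) edge set \<Rightarrow> ('w, 'f) edge set" where
  "choiceW G w Z = {e \<in> Z. \<forall>e' \<in> Z. e' \<noteq> e \<longrightarrow> gt G w e e'}"


section \<open>Stable matchings\<close>

definition acceptable :: "('w, 'f) market \<Rightarrow> ('w, 'f) edge set \<Rightarrow> bool" where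
  "acceptable G X \<longleftrightarrow> X \<subseteq> E G \<and>
     (\<forall>w \<in> WV G. choiceW G w (atW X w) = atW X w) \<and>
     (\<forall>f \<in> FV G. choiceF G f (atF X f) = atF X f)"

definition succ_F :: "('w, 'f) market \<Rightarrow> ('w, 'f) edge set \<Rightarrow> ('w, 'f) edge set \<Rightarrow> bool" where
  "succ_F G X Y \<longleftrightarrow> acceptable G X \<and> acceptable G Y \<and> X \<noteq> Y \<and>
     (\<forall>f \<in> FV G. choiceF G f (atF X f \<union> atF Y f) = atF X f)"

definition stable :: "('w, 'f) market \<Rightarrow> ('w, 'f) edge set \<Rightarrow> bool" where
  "stable G X \<longleftrightarrow> acceptable G X \<and>
     \<not> (\<exists>w f. (w, f) \<in> E G - X \<and>
            (w, f) \<in> choiceW G w (atW X w \<union> {(w, f)}) \<and>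
            (w, f) \<in> choiceF G f (atF X f \<union> {(w, f)}))"

definition stable_matchings :: "('w, 'f) market \<Rightarrow> ('w, 'f) edge set set" where
  "stable_matchings G = {X. stable G X}"

definition X_min :: "('w, 'f) market \<Rightarrow> ('w, 'f) edge set" where
  "X_min G = (THE X. X \<in> stable_matchings G \<and>
     (\<forall>Y \<in> stable_matchings G. Y \<noteq> X \<longrightarrow> succ_F G Y X))"

definition X_max :: "('w, 'f) market \<Rightarrow> ('w, 'f) edge set" where
  "X_max G = (THE X. X \<in> stable_matchings G \<and>
     (\<forall>Y \<in> stable_matchings G. Y \<noteq> X \<longrightarrow> succ_F G X Y))"


section \<open>Active graph and rotations\<close>

definition W_candidates :: "('w, 'f) market \<Rightarrow> ('w, 'f) edge set \<Rightarrow> 'w \<Rightarrow> ('w, 'f) edge set" where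
  "W_candidates G X w = {e \<in> atW (E G) w.
     \<exists>x. atW X w = {x} \<and> gt G w x e \<and> e \<in> choiceF G (snd e) (atF X (snd e) \<union> {e})}"

definition W_admissible :: "('w, 'f) market \<Rightarrow> ('w, 'f) edge set \<Rightarrow> ('w, 'f) edge \<Rightarrow> bool" where
  "W_admissible G X a \<longleftrightarrow> fst a \<in> WV G \<and> a \<in> choiceW G (fst a) (W_candidates G X (fst a))"

definition tandem ::
  "('w, 'f) market \<Rightarrow> ('w, 'f) edge set \<Rightarrow> ('w, 'f) edge \<Rightarrow> ('w, 'f) edge \<Rightarrow> bool" where
  "tandem G X a b \<longleftrightarrow> W_admissible G X a \<and> b \<in> atF X (snd a) \<and>
     choiceF G (snd a) (atF X (snd a) \<union> {a}) = (atF X (snd a) - {b}) \<union> {a}"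

definition F_admissible :: "('w, 'f) market \<Rightarrow> ('w, 'f) edge set \<Rightarrow> ('w, 'f) edge \<Rightarrow> bool" where
  "F_admissible G X b \<longleftrightarrow> (\<exists>a. tandem G X a b)"

text \<open>A directed graph is represented by the pair \<open>(P, M)\<close> of its sets of edges directed from
  \<open>W\<close> to \<open>F\<close> and from \<open>F\<close> to \<open>W\<close>; isolated vertices thereby disappear by themselves.\<close>

type_synonym ('w, 'f) dgraph = "('w, 'f) edge set \<times> ('w, 'f) edge set"

definition D_graph :: "('w, 'f) market \<Rightarrow> ('w, 'f) edge set \<Rightarrow> ('w, 'f) dgraph" where
  "D_graph G X = ({a. W_admissible G X a}, {b. F_admissible G X b})"

inductive clean_step ::
  "('w, 'f) market \<Rightarrow> ('w, 'f) edge set \<Rightarrow> ('w, 'f) dgraph \<Rightarrow> ('w, 'f) dgraph \<Rightarrow> bool"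
  for G X where
  "\<lbrakk>a \<in> P; \<forall>b \<in> M. fst b \<noteq> fst a\<rbrakk> \<Longrightarrow>
   clean_step G X (P, M)
     (P - {a}, M - {b. tandem G X a b \<and> \<not> (\<exists>a' \<in> P. a' \<noteq> a \<and> tandem G X a' b)})"

definition active_graph :: "('w, 'f) market \<Rightarrow> ('w, 'f) edge set \<Rightarrow> ('w, 'f) dgraph" where
  "active_graph G X = (THE H. (clean_step G X)\<^sup>*\<^sup>* (D_graph G X) H \<and> (\<nexists>H'. clean_step G X H H'))"

text \<open>A rotation is the pair \<open>(L\<^sup>+, L\<^sup>-)\<close>. The cycle itself is given by the cyclic list \<open>ts\<close> of
  the tandems it traverses; the last condition says that the edge \<open>b\<close> of each tandem enters
  the \<open>W\<close>-vertex which the edge \<open>a\<close> of the cyclically next tandem leaves. Since every such vertex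
  has one entering and one leaving edge, these edge-simple cycles are precisely the members of
  the cycle decomposition of the active graph.\<close>

type_synonym ('w, 'f) rotation = "('w, 'f) edge set \<times> ('w, 'f) edge set"

definition tandem_cycle :: "('w, 'f) market \<Rightarrow> ('w, 'f) edge set \<Rightarrow>
    (('w, 'f) edge \<times> ('w, 'f) edge) list \<Rightarrow> bool" where
  "tandem_cycle G X ts \<longleftrightarrow> ts \<noteq> [] \<and> distinct (map fst ts) \<and> distinct (map snd ts) \<and>
     (\<forall>(a, b) \<in> set ts.
        a \<in> fst (active_graph G X) \<and> b \<in> snd (active_graph G X) \<and> tandem G X a b) \<and>
     (\<forall>i < length ts. fst (snd (ts ! i)) = fst (fst (ts ! (Suc i mod length ts))))"

definition generated_rotations ::
  "('w, 'f) market \<Rightarrow> ('w, 'f) edge set \<Rightarrow> ('w, 'f) rotation set" where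
  "generated_rotations G X = {(set (map fst ts), set (map snd ts)) | ts. tandem_cycle G X ts}"

definition apply_rotation :: "('w, 'f) rotation \<Rightarrow> ('w, 'f) edge set \<Rightarrow> ('w, 'f) edge set" where
  "apply_rotation L X = (X - snd L) \<union> fst L"


section \<open>The poset of rotations\<close>

text \<open>\<open>route G X Ls Y\<close>: applying the rotations in \<open>Ls\<close>, from left to right, is a route from the
  stable matching \<open>X\<close> to \<open>Y\<close>.\<close>

inductive route :: "('w, 'f) market \<Rightarrow> ('w, 'f) edge set \<Rightarrow> ('w, 'f) rotation list \<Rightarrow>
    ('w, 'f) edge set \<Rightarrow> bool" for G X\<^sub>0 where
  route_Nil: "stable G X\<^sub>0 \<Longrightarrow> route G X\<^sub>0 [] X\<^sub>0"
| route_snoc: "\<lbrakk>route G X\<^sub>0 Ls X; L \<in> generated_rotations G X\<rbrakk>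
    \<Longrightarrow> route G X\<^sub>0 (Ls @ [L]) (apply_rotation L X)"

definition full_route :: "('w, 'f) market \<Rightarrow> ('w, 'f) rotation list \<Rightarrow> bool" where
  "full_route G Ls \<longleftrightarrow> route G (X_min G) Ls (X_max G)"

text \<open>All full routes have the same set of rotations, so the union below is that common set.\<close>

definition rotations :: "('w, 'f) market \<Rightarrow> ('w, 'f) rotation set" where
  "rotations G = (\<Union>Ls \<in> {Ls. full_route G Ls}. set Ls)"

definition rot_less ::
  "('w, 'f) market \<Rightarrow> ('w, 'f) rotation \<Rightarrow> ('w, 'f) rotation \<Rightarrow> bool" where
  "rot_less G R R' \<longleftrightarrow> R \<in> rotations G \<and> R' \<in> rotations G \<and>
     (\<forall>Ls. full_route G Ls \<longrightarrow> (\<exists>i j. i < j \<and> j < length Ls \<and> Ls ! i = R \<and> Ls ! j = R'))"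

definition rot_ideal :: "('w, 'f) market \<Rightarrow> ('w, 'f) rotation set \<Rightarrow> bool" where
  "rot_ideal G I \<longleftrightarrow> I \<subseteq> rotations G \<and> (\<forall>R R'. rot_less G R R' \<and> R' \<in> I \<longrightarrow> R \<in> I)"


section \<open>The correspondence\<close>

text \<open>Elements of \<open>\<real>\<^sup>U\<close> are functions that are \<open>undefined\<close> outside of \<open>U\<close>.\<close>

definition char_vec :: "'a set \<Rightarrow> 'a set \<Rightarrow> 'a \<Rightarrow> real" where
  "char_vec U S = (\<lambda>u \<in> U. indicator S u)"

definition A_matrix :: "('w, 'f) edge \<Rightarrow> ('w, 'f) rotation \<Rightarrow> real" where
  "A_matrix e R = (if e \<in> fst R then 1 else if e \<in> snd R then -1 else 0)"

definition gamma ::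
  "('w, 'f) market \<Rightarrow> (('w, 'f) rotation \<Rightarrow> real) \<Rightarrow> ('w, 'f) edge \<Rightarrow> real" where
  "gamma G l = (\<lambda>e \<in> E G. char_vec (E G) (X_min G) e + (\<Sum>R \<in> rotations G. A_matrix e R * l R))"

end

theory Submission
  imports Defs
begin

text \<open>
  The idea is to represent the lattice of stable matchings as a ring of sets and to read the
  bijection off Birkhoff's description of such a ring.

  Write \<open>C\<close> for the joint choice function of the \<open>F\<close>-side, and let \<open>upper X\<close> be the set of edges
  that the \<open>W\<close>-side would accept when holding \<open>X\<close>. Consistency and substitutability turn
  stability of a matching \<open>X\<close> into the fixed-point equation \<open>C (upper X) = X\<close> (\<open>stable_iff\<close>), so
  \<open>X\<close> is determined by \<open>upper X\<close>. Monotonicity of cardinality shows that the sets \<open>upper X\<close> of the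
  stable \<open>X\<close> are closed under union and intersection (\<open>stable_join_matched\<close>, \<open>stable_meet\<close>).
  Inclusion of these sets is the order \<open>\<prec>\<^sub>F\<close>, so \<open>X_min\<close> and \<open>X_max\<close> have the least and the
  greatest of them.

  Applying a rotation \<open>L\<close> to \<open>X\<close> gives a stable matching whose upper set is that of \<open>X\<close> extended by
  a nonempty set \<open>block L\<close>, the intervals between \<open>L\<^sup>-\<close> and \<open>L\<^sup>+\<close> in the preferences of \<open>W\<close>. From
  \<open>X\<close> there is a rotation towards every stable \<open>Y\<close> above it (\<open>rotation_towards\<close>), hence the
  rotations generated by \<open>X\<close> are covering steps of the ring (\<open>rotation_covers\<close>). In a ring of
  sets, the difference set of a covering step is contained in or disjoint from every member
  (\<open>block_all_or_nothing\<close>), so two such differences are equal or disjoint; and \<open>block L\<close>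
  determines \<open>L\<close> (\<open>rotation_eq_if_blocks_meet\<close>).

  Consequently any route from \<open>X_min\<close> to \<open>X\<close> uses each rotation at most once, and it uses exactly
  the set \<open>passed X\<close> of the rotations whose block lies in \<open>upper X\<close>. Summing the changes along the
  route gives \<open>\<gamma> (\<chi>\<^bsup>passed X\<^esup>) = \<chi>\<^bsup>X\<^esup>\<close> (\<open>gamma_passed\<close>). It remains to see that the ideals are
  exactly the sets \<open>passed X\<close> (\<open>passed_ideal\<close>, \<open>ideal_is_passed\<close>), and injectivity follows because
  \<open>X\<close> determines \<open>passed X\<close>.
\<close>

section \<open>Preferences and the joint choice function\<close>

context choice_market
begin

text \<open>With membership in \<open>E G\<close> and the common \<open>W\<close>-vertex built in, this is a strict partial order
  on all pairs, and its laws need no side conditions.\<close>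

definition better :: "('w, 'f) edge \<Rightarrow> ('w, 'f) edge \<Rightarrow> bool" where
  "better e e' \<longleftrightarrow> e \<in> E G \<and> e' \<in> E G \<and> fst e = fst e' \<and> gt G (fst e) e e'"

lemma finite_E: "finite (E G)"
  using finite_subset[OF edges] finite_WV finite_FV by blast

lemma edge_ends: "e \<in> E G \<Longrightarrow> fst e \<in> WV G \<and> snd e \<in> FV G"
  using edges by auto

lemma better_irrefl: "\<not> better e e"
  using irreflp_onD[OF gt_irrefl, of "fst e" e] edge_ends by (auto simp: better_def atW_def)

lemma better_trans: "better e e' \<Longrightarrow> better e' e'' \<Longrightarrow> better e e''"
  using transp_onD[OF gt_trans, of "fst e" e e' e''] edge_ends by (auto simp: better_def atW_def)

lemma better_asym: "better e e' \<Longrightarrow> \<not> better e' e"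
  using better_irrefl better_trans by blast

lemma better_total:
  "e \<in> E G \<Longrightarrow> e' \<in> E G \<Longrightarrow> fst e = fst e' \<Longrightarrow> e = e' \<or> better e e' \<or> better e' e"
  using totalp_onD[OF gt_total, of "fst e" e e'] edge_ends by (auto simp: better_def atW_def)

lemma better_fst: "better e e' \<Longrightarrow> fst e = fst e'"
  by (simp add: better_def)

lemma ex_best:
  assumes "K \<subseteq> E G" "K \<noteq> {}" "\<And>e e'. e \<in> K \<Longrightarrow> e' \<in> K \<Longrightarrow> fst e = fst e'"
  shows "\<exists>m\<in>K. \<forall>e\<in>K. e = m \<or> better m e"
proof -
  have "asymp_on K better" "transp_on K better"
    using better_asym better_trans by (metis asymp_onI, metis transp_onI)
  then obtain m where "m \<in> K" "\<forall>e\<in>K. e \<noteq> m \<longrightarrow> \<not> better e m"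
    using Finite_Set.bex_min_element[OF finite_subset[OF assms(1) finite_E] _ _ assms(2)] by metis
  then show ?thesis using better_total assms by (metis subsetD)
qed

definition chosen :: "('w, 'f) edge set \<Rightarrow> ('w, 'f) edge set" where
  "chosen Z = {e \<in> Z. e \<in> choiceF G (snd e) (atF Z (snd e))}"

lemma atF_mono: "Z' \<subseteq> Z \<Longrightarrow> atF Z' f \<subseteq> atF Z f"
  by (auto simp: atF_def)

lemma atF_chosen:
  assumes "Z \<subseteq> E G" "f \<in> FV G"
  shows "atF (chosen Z) f = choiceF G f (atF Z f)"
  using choice_subset[OF assms(2) atF_mono[OF assms(1)]] by (auto simp: chosen_def atF_def)

lemma eq_if_atF_eq:
  assumes "X \<subseteq> E G" "Y \<subseteq> E G" "\<And>f. f \<in> FV G \<Longrightarrow> atF X f = atF Y f"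
  shows "X = Y"
proof -
  have "e \<in> X \<longleftrightarrow> e \<in> Y" if "e \<in> E G" for e
    using assms(3)[of "snd e"] edge_ends[OF that] by (auto simp: atF_def)
  then show ?thesis using assms(1,2) by blast
qed

lemma chosen_subset: "chosen Z \<subseteq> Z"
  by (auto simp: chosen_def)

lemma chosen_consistent:
  assumes "Z \<subseteq> E G" "Z' \<subseteq> Z" "chosen Z \<subseteq> Z'"
  shows "chosen Z' = chosen Z"
proof (rule eq_if_atF_eq)
  fix f assume f: "f \<in> FV G"
  have "choiceF G f (atF Z' f) = choiceF G f (atF Z f)"
    using A1[OF f atF_mono[OF assms(1)] atF_mono[OF assms(2)]] atF_chosen[OF assms(1) f]
      atF_mono[OF assms(3), of f] by simp
  then show "atF (chosen Z') f = atF (chosen Z) f"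
    using atF_chosen f assms by (metis subset_trans)
qed (use assms chosen_subset in blast)+

lemma chosen_substitutable:
  assumes "Z \<subseteq> E G" "Z' \<subseteq> Z" "e \<in> chosen Z" "e \<in> Z'"
  shows "e \<in> chosen Z'"
proof -
  have "snd e \<in> FV G" using assms edge_ends by blast
  from A2[OF this atF_mono[OF assms(1)] atF_mono[OF assms(2)]] assms(3,4)
  show ?thesis by (auto simp: chosen_def atF_def)
qed

lemma card_chosen_mono:
  assumes "Z \<subseteq> E G" "Z' \<subseteq> Z"
  shows "card (chosen Z') \<le> card (chosen Z)"
proof -
  have card_eq: "card (chosen T) = (\<Sum>f\<in>FV G. card (choiceF G f (atF T f)))" if T: "T \<subseteq> E G" for T
  proof -
    have sub: "chosen T \<subseteq> E G" using chosen_subset T by blast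
    have "chosen T = (\<Union>f\<in>FV G. atF (chosen T) f)"
      using sub edge_ends by (fastforce simp: atF_def)
    moreover have "card (\<Union>f\<in>FV G. atF (chosen T) f) = (\<Sum>f\<in>FV G. card (atF (chosen T) f))"
      by (rule card_UN_disjoint)
        (use finite_FV finite_subset[OF sub finite_E] in \<open>auto simp: atF_def\<close>)
    ultimately show ?thesis using atF_chosen[OF T] by simp
  qed
  have Z': "Z' \<subseteq> E G" using assms by blast
  show ?thesis unfolding card_eq[OF assms(1)] card_eq[OF Z']
    by (intro sum_mono A3[OF _ atF_mono[OF assms(1)] atF_mono[OF assms(2)]])
qed

section \<open>Stable matchings as a ring of sets\<close>

text \<open>At a vertex matched by \<open>X\<close> these are the edges at least as good as its partner edge, at an
  unmatched one all its edges. An unmatched vertex and one holding its worst edge thus look alike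
  here; for stable matchings this causes no ambiguity, as they all match the same vertices.\<close>

definition upper :: "('w, 'f) edge set \<Rightarrow> ('w, 'f) edge set" where
  "upper X = {e \<in> E G. \<forall>x \<in> X. \<not> better x e}"

lemma upper_subset: "upper X \<subseteq> E G"
  by (auto simp: upper_def)

lemma subset_upper:
  assumes "X \<subseteq> E G" "inj_on fst X"
  shows "X \<subseteq> upper X"
proof -
  have "\<not> better x e" if "x \<in> X" "e \<in> X" for x e
    using inj_onD[OF assms(2), of x e] that better_fst[of x e] better_irrefl by blast
  then show ?thesis using assms(1) unfolding upper_def by blast
qed

lemma acceptable_iff:
  "acceptable G X \<longleftrightarrow> X \<subseteq> E G \<and> inj_on fst X \<and> chosen X = X"
proof (cases "X \<subseteq> E G")
  case True
  have "(\<forall>w \<in> WV G. choiceW G w (atW X w) = atW X w) \<longleftrightarrow> inj_on fst X"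
  proof
    assume L: "\<forall>w \<in> WV G. choiceW G w (atW X w) = atW X w"
    have imp: "gt G (fst x) x y" if "x \<in> X" "y \<in> X" "fst x = fst y" "x \<noteq> y" for x y
    proof -
      have "fst x \<in> WV G" using that True edge_ends by blast
      then have "x \<in> choiceW G (fst x) (atW X (fst x))" using L that by (auto simp: atW_def)
      moreover have "y \<in> atW X (fst x)" using that by (simp add: atW_def)
      ultimately show ?thesis using that by (simp add: choiceW_def)
    qed
    show "inj_on fst X"
    proof (rule inj_onI, rule ccontr)
      fix x y assume xy: "x \<in> X" "y \<in> X" "fst x = fst y" "x \<noteq> y"
      then have "better x y" "better y x"
        using imp[of x y] imp[of y x] True by (auto simp: better_def)
      then show False using better_asym by blast
    qed
  next
    assume inj: "inj_on fst X"
    then show "\<forall>w \<in> WV G. choiceW G w (atW X w) = atW X w"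
      unfolding choiceW_def atW_def by (blast dest: inj_onD)
  qed
  moreover have "(\<forall>f \<in> FV G. choiceF G f (atF X f) = atF X f) \<longleftrightarrow> chosen X = X"
    using atF_chosen[OF True] eq_if_atF_eq[of "chosen X" X] chosen_subset[of X] True
    by (metis subset_trans)
  ultimately show ?thesis using True by (auto simp: acceptable_def)
qed (auto simp: acceptable_def)

text \<open>If no edge of \<open>Z\<close> can join \<open>X\<close> on its own, substitutability shows that offering all of
  \<open>Z\<close> at once changes nothing either.\<close>

lemma chosen_eqI:
  assumes "X \<subseteq> Z" "Z \<subseteq> E G" "chosen X = X" "\<And>e. e \<in> Z - X \<Longrightarrow> e \<notin> chosen (insert e X)"
  shows "chosen Z = X"
proof -
  have "chosen Z \<subseteq> X"
  proof
    fix e assume e: "e \<in> chosen Z"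
    then have "e \<in> Z" using chosen_subset by blast
    then have "e \<in> chosen (insert e X)"
      using chosen_substitutable[OF assms(2) _ e, of "insert e X"] assms(1) by blast
    then show "e \<in> X" using assms(4) \<open>e \<in> Z\<close> by blast
  qed
  then show ?thesis using chosen_consistent[OF assms(2,1)] assms(3) by blast
qed

text \<open>Stability as a fixed-point equation: by substitutability the absence of blocking edges
  says that the \<open>F\<close>-side, offered at once all edges that the \<open>W\<close>-side would accept, keeps exactly
  \<open>X\<close>. All use of stability below goes through this form.\<close>

lemma stable_iff:
  "stable G X \<longleftrightarrow> X \<subseteq> E G \<and> inj_on fst X \<and> chosen (upper X) = X"
proof -
  have block: "(w, f) \<in> choiceW G w (atW X w \<union> {(w, f)}) \<and>
      (w, f) \<in> choiceF G f (atF X f \<union> {(w, f)}) \<longleftrightarrow>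
      (w, f) \<in> upper X \<and> (w, f) \<in> chosen (insert (w, f) X)"
    if X: "X \<subseteq> E G" and e: "(w, f) \<in> E G - X" for w f
  proof -
    have "atF (insert (w, f) X) f = atF X f \<union> {(w, f)}" by (auto simp: atF_def)
    then have "(w, f) \<in> choiceF G f (atF X f \<union> {(w, f)}) \<longleftrightarrow> (w, f) \<in> chosen (insert (w, f) X)"
      by (simp add: chosen_def)
    moreover have "(w, f) \<in> choiceW G w (atW X w \<union> {(w, f)}) \<longleftrightarrow>
        (\<forall>x \<in> X. fst x = w \<longrightarrow> better (w, f) x)"
      using X e by (auto simp: choiceW_def atW_def better_def)
    moreover have "\<dots> \<longleftrightarrow> (w, f) \<in> upper X"
    proof
      assume "\<forall>x \<in> X. fst x = w \<longrightarrow> better (w, f) x"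
      then show "(w, f) \<in> upper X"
        using e better_asym better_fst by (fastforce simp: upper_def)
    next
      assume u: "(w, f) \<in> upper X"
      show "\<forall>x \<in> X. fst x = w \<longrightarrow> better (w, f) x"
        using u e X better_total[of "(w, f)"] by (auto simp: upper_def) blast
    qed
    ultimately show ?thesis by blast
  qed
  show ?thesis
  proof
    assume st: "stable G X"
    then have X: "X \<subseteq> E G" "inj_on fst X" "chosen X = X"
      by (auto simp: stable_def acceptable_iff)
    have "chosen (upper X) = X"
    proof (rule chosen_eqI)
      fix e assume e: "e \<in> upper X - X"
      obtain w f where [simp]: "e = (w, f)" by force
      have "(w, f) \<in> E G - X" using e upper_subset by auto
      then show "e \<notin> chosen (insert e X)"
        using st e block[OF X(1), of w f] by (auto simp: stable_def)
    qed (use X subset_upper upper_subset in auto)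
    then show "X \<subseteq> E G \<and> inj_on fst X \<and> chosen (upper X) = X" using X by blast
  next
    assume X: "X \<subseteq> E G \<and> inj_on fst X \<and> chosen (upper X) = X"
    then have sub: "X \<subseteq> upper X" using subset_upper by blast
    have "chosen X = X" using chosen_consistent[OF upper_subset sub] X by simp
    moreover have "e \<notin> chosen (insert e X)" if "e \<in> upper X" "e \<notin> X" for e
      using chosen_consistent[OF upper_subset, of "insert e X" X] X sub that by auto
    ultimately show "stable G X"
      using X block unfolding stable_def acceptable_iff by blast
  qed
qed

lemma stable_subset: "stable G X \<Longrightarrow> X \<subseteq> E G"
  and stable_inj: "stable G X \<Longrightarrow> inj_on fst X"
  and stable_chosen_upper: "stable G X \<Longrightarrow> chosen (upper X) = X"
  by (simp_all add: stable_iff)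

lemma stable_subset_upper: "stable G X \<Longrightarrow> X \<subseteq> upper X"
  using subset_upper stable_iff by blast

lemma stable_finite: "stable G X \<Longrightarrow> finite X"
  using stable_subset finite_E finite_subset by blast

lemma stable_chosen: "stable G X \<Longrightarrow> chosen X = X"
  by (simp add: stable_def acceptable_iff)

lemma stable_chosen_between:
  "stable G X \<Longrightarrow> X \<subseteq> Z \<Longrightarrow> Z \<subseteq> upper X \<Longrightarrow> chosen Z = X"
  using chosen_consistent[OF upper_subset] stable_chosen_upper by metis

lemma upperI:
  assumes "stable G X" "e \<in> E G" "x \<in> X" "fst x = fst e" "\<not> better x e"
  shows "e \<in> upper X"
proof -
  have "\<not> better y e" if "y \<in> X" for y
    using inj_onD[OF stable_inj[OF assms(1)], of y x] better_fst[of y e] assms that by auto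
  then show ?thesis using assms(2) by (simp add: upper_def)
qed

lemma not_upperE:
  assumes "e \<in> E G" "e \<notin> upper X"
  obtains x where "x \<in> X" "better x e" "fst x = fst e"
  using assms better_fst by (auto simp: upper_def)

text \<open>The join is what the \<open>F\<close>-side chooses from \<open>upper X \<union> upper Y\<close>. Substitutability gives
  each \<open>w\<close> at most the worse of its two edges; monotonicity of cardinality then forces every \<open>w\<close>
  matched in \<open>X\<close> or in \<open>Y\<close> to be matched in the join, which is also why all stable matchings
  cover the same vertices of \<open>W\<close>.\<close>

lemma stable_join_matched:
  assumes X: "stable G X" and Y: "stable G Y"
  shows "fst ` X = fst ` Y \<and> (\<exists>Z. stable G Z \<and> upper Z = upper X \<union> upper Y)"
proof -
  define Z where "Z = chosen (upper X \<union> upper Y)"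
  have sub: "upper X \<union> upper Y \<subseteq> E G" using upper_subset by blast
  have ZX: "e \<in> X" if "e \<in> Z" "e \<in> upper X" for e
    using chosen_substitutable[OF sub, of "upper X" e] that stable_chosen_upper[OF X]
    by (auto simp: Z_def)
  have ZY: "e \<in> Y" if "e \<in> Z" "e \<in> upper Y" for e
    using chosen_substitutable[OF sub, of "upper Y" e] that stable_chosen_upper[OF Y]
    by (auto simp: Z_def)
  have Zsub: "Z \<subseteq> upper X \<union> upper Y" using chosen_subset by (auto simp: Z_def)
  then have ZE: "Z \<subseteq> E G" and ZXY: "Z \<subseteq> X \<union> Y" using sub ZX ZY by blast+
  have inj: "inj_on fst Z"
  proof (rule inj_onI, rule ccontr)
    fix e e' assume e: "e \<in> Z" "e' \<in> Z" "fst e = fst e'" "e \<noteq> e'"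
    have aux: False if "e \<in> X" "e' \<in> Y" "e \<in> Z" "e' \<in> Z" "fst e = fst e'" "e \<noteq> e'" for e e'
    proof -
      have "e \<notin> upper Y" using ZY that stable_inj[OF Y] by (metis inj_onD)
      then have 1: "better e' e" using upperI[OF Y, of e e'] that ZE by auto
      have "e' \<notin> upper X" using ZX that stable_inj[OF X] by (metis inj_onD)
      then have "better e e'" using upperI[OF X, of e' e] that ZE by auto
      then show False using 1 better_asym by blast
    qed
    have "(e \<in> X \<and> e' \<in> X) \<or> (e \<in> Y \<and> e' \<in> Y) \<or> (e \<in> X \<and> e' \<in> Y) \<or> (e \<in> Y \<and> e' \<in> X)"
      using e ZXY by blast
    then show False
      using e aux[of e e'] aux[of e' e] stable_inj[OF X] stable_inj[OF Y]
      by (auto simp: inj_on_def)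
  qed
  have matched: "fst ` Z \<subseteq> fst ` X \<inter> fst ` Y"
  proof
    fix w assume "w \<in> fst ` Z"
    then obtain e where e: "e \<in> Z" "w = fst e" by blast
    have "fst e \<in> fst ` X" using ZX[OF e(1)] not_upperE[of e X] e ZE by (metis imageI subsetD)
    moreover have "fst e \<in> fst ` Y" using ZY[OF e(1)] not_upperE[of e Y] e ZE by (metis imageI subsetD)
    ultimately show "w \<in> fst ` X \<inter> fst ` Y" using e by blast
  qed
  have "card X \<le> card Z" "card Y \<le> card Z"
    using card_chosen_mono[OF sub, of "upper X"] card_chosen_mono[OF sub, of "upper Y"]
      stable_chosen_upper[OF X] stable_chosen_upper[OF Y] by (auto simp: Z_def)
  then have "card (fst ` X) \<le> card (fst ` Z)" "card (fst ` Y) \<le> card (fst ` Z)"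
    using card_image[OF inj] card_image[OF stable_inj[OF X]] card_image[OF stable_inj[OF Y]]
    by simp_all
  then have fX: "fst ` Z = fst ` X" and fY: "fst ` Z = fst ` Y"
    using matched stable_finite[OF X] stable_finite[OF Y]
    by (meson card_seteq finite_imageI le_inf_iff)+
  have up: "upper Z = upper X \<union> upper Y"
  proof
    show "upper Z \<subseteq> upper X \<union> upper Y"
    proof
      fix e assume e: "e \<in> upper Z"
      then have eE: "e \<in> E G" using upper_subset by blast
      show "e \<in> upper X \<union> upper Y"
      proof (cases "fst e \<in> fst ` Z")
        case True
        then obtain z where z: "z \<in> Z" "fst z = fst e" by fastforce
        then have "\<not> better z e" using e by (auto simp: upper_def)
        then show ?thesis using z ZXY upperI[OF X eE, of z] upperI[OF Y eE, of z] by blast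
      next
        case False
        then show ?thesis using not_upperE[OF eE, of X] fX by (metis UnI1 image_eqI)
      qed
    qed
  next
    have aux: "upper X \<subseteq> upper Z" if X: "stable G X" and ZXY: "Z \<subseteq> X \<union> Y" and
      ZX: "\<And>e. e \<in> Z \<Longrightarrow> e \<in> upper X \<Longrightarrow> e \<in> X" for X Y
    proof
      fix e assume e: "e \<in> upper X"
      have "\<not> better z e" if z: "z \<in> Z" for z
      proof (cases "z \<in> upper X")
        case True
        then show ?thesis using ZX z e by (auto simp: upper_def)
      next
        case False
        then obtain x where "x \<in> X" "better x z" using not_upperE[of z X] z ZE by blast
        then show ?thesis using better_trans[of x z e] e by (auto simp: upper_def)
      qed
      then show "e \<in> upper Z" using e by (auto simp: upper_def)
    qed
    show "upper X \<union> upper Y \<subseteq> upper Z"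
      using aux[OF X ZXY ZX] aux[of Y X, OF Y _ ZY] ZXY by blast
  qed
  have "chosen (upper Z) = Z" unfolding up by (rule Z_def[symmetric])
  then have "stable G Z" using ZE inj stable_iff[of Z] by simp
  moreover have "fst ` X = fst ` Y" using fX fY by simp
  ultimately show ?thesis using up by (intro conjI exI[of _ Z])
qed

lemma stable_join:
  assumes "stable G X" "stable G Y"
  obtains Z where "stable G Z" "upper Z = upper X \<union> upper Y"
  using conjunct2[OF stable_join_matched[OF assms]] by blast

lemma stable_card_eq: "stable G X \<Longrightarrow> stable G Y \<Longrightarrow> card X = card Y"
  using conjunct1[OF stable_join_matched, of X Y] card_image[OF stable_inj, of X]
    card_image[OF stable_inj, of Y] by simp

text \<open>Here substitutability gives the other inclusion: each better edge is chosen from the smaller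
  set \<open>upper X \<inter> upper Y\<close>, and there are already \<open>|X|\<close> of them because \<open>X\<close> and \<open>Y\<close> match the same
  vertices, so nothing more can be chosen.\<close>

lemma stable_meet:
  assumes X: "stable G X" and Y: "stable G Y"
  obtains Z where "stable G Z" "upper Z = upper X \<inter> upper Y"
proof
  define Z where "Z = (X \<inter> upper Y) \<union> (Y \<inter> upper X)"
  have mat: "fst ` X = fst ` Y" by (rule conjunct1[OF stable_join_matched[OF X Y]])
  have ZE: "Z \<subseteq> E G"
    using stable_subset[OF X] stable_subset[OF Y] unfolding Z_def by blast
  have Z: "Z \<subseteq> X \<union> Y" "Z \<subseteq> upper X \<inter> upper Y"
    using stable_subset_upper[OF X] stable_subset_upper[OF Y] unfolding Z_def by blast+
  have inj: "inj_on fst Z"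
  proof (rule inj_onI)
    fix e e' assume e: "e \<in> Z" "e' \<in> Z" "fst e = fst e'"
    have "\<not> better e e'" if "e \<in> Z" "e' \<in> Z" for e e'
      using Z that unfolding upper_def by blast
    then show "e = e'" using better_total[of e e'] e ZE by blast
  qed
  have best: "\<exists>z \<in> Z. fst z = fst x \<and> (z = x \<or> better z x)" if "x \<in> X \<union> Y" for x
  proof -
    have aux: "\<exists>z \<in> (X \<inter> upper Y) \<union> (Y \<inter> upper X). fst z = fst x \<and> (z = x \<or> better z x)"
      if X: "stable G X" and Y: "stable G Y" and x: "x \<in> X" for x X Y
    proof (cases "x \<in> upper Y")
      case False
      have xE: "x \<in> E G" using stable_subset[OF X] x by blast
      then obtain y where y: "y \<in> Y" "better y x" using False not_upperE by blast
      then have "y \<in> upper X"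
        using upperI[OF X, of y x] stable_subset[OF Y] x better_asym better_fst by (metis subsetD)
      then show ?thesis using y better_fst by blast
    qed (use x in blast)
    show ?thesis using aux[OF X Y] aux[OF Y X] that unfolding Z_def by blast
  qed
  show up: "upper Z = upper X \<inter> upper Y"
  proof
    show "upper X \<inter> upper Y \<subseteq> upper Z" by (auto simp: upper_def Z_def)
    show "upper Z \<subseteq> upper X \<inter> upper Y"
    proof
      fix e assume e: "e \<in> upper Z"
      have "\<not> better x e" if x: "x \<in> X \<union> Y" for x
      proof -
        obtain z where "z \<in> Z" "z = x \<or> better z x" using best[OF x] by blast
        then show ?thesis using better_trans[of z x e] e unfolding upper_def by blast
      qed
      then show "e \<in> upper X \<inter> upper Y" using e by (auto simp: upper_def)
    qed
  qed
  have "Z \<subseteq> chosen (upper X \<inter> upper Y)"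
    using chosen_substitutable[OF upper_subset[of X], of "upper X \<inter> upper Y"]
      chosen_substitutable[OF upper_subset[of Y], of "upper X \<inter> upper Y"]
      stable_chosen_upper[OF X] stable_chosen_upper[OF Y]
      stable_subset_upper[OF X] stable_subset_upper[OF Y]
    by (auto simp: Z_def)
  moreover have "card (chosen (upper X \<inter> upper Y)) \<le> card Z"
  proof -
    have "card (chosen (upper X \<inter> upper Y)) \<le> card X"
      using card_chosen_mono[OF upper_subset[of X], of "upper X \<inter> upper Y"]
        stable_chosen_upper[OF X] by simp
    also have "card X = card (fst ` X)" using card_image[OF stable_inj[OF X]] by simp
    also have "\<dots> \<le> card (fst ` Z)"
    proof (rule card_mono)
      show "fst ` X \<subseteq> fst ` Z"
      proof
        fix w assume "w \<in> fst ` X"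
        then obtain x where "x \<in> X" "w = fst x" by blast
        then show "w \<in> fst ` Z" using best[of x] by (metis UnI1 image_eqI)
      qed
    qed (use finite_subset[OF ZE finite_E] in blast)
    also have "\<dots> = card Z" using card_image[OF inj] .
    finally show ?thesis .
  qed
  moreover have "finite (chosen (upper X \<inter> upper Y))"
    using chosen_subset upper_subset finite_E finite_subset by (metis le_infI1)
  ultimately have "Z = chosen (upper Z)" using card_seteq up by metis
  then show "stable G Z" using ZE inj stable_iff[of Z] by simp
qed

text \<open>Deferred acceptance as a fixed point: \<open>A\<close> holds the edges not refused by the \<open>W\<close>-side
  when it is offered \<open>B\<close>, and \<open>B\<close> those not refused by the \<open>F\<close>-side when it is offered \<open>A\<close>. Both
  refusal maps are monotone, so Knaster-Tarski yields such a pair, and \<open>A \<inter> B\<close> is stable.\<close>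

lemma stable_exists: "\<exists>X. stable G X"
proof -
  \<comment> \<open>\<open>T A\<close> is what the \<open>F\<close>-side leaves open when offered \<open>A\<close>; it plays the role of \<open>B\<close>.\<close>
  define best where "best B = {e \<in> B. \<forall>e' \<in> B. \<not> better e' e}" for B
  define T where "T A = E G - (A - chosen A)" for A
  define H where "H A = E G - (T A - best (T A))" for A
  define g where "g A = H (A \<inter> E G)" for A
  have "mono g"
  proof (rule monoI)
    fix A B :: "('w, 'f) edge set" assume AB: "A \<subseteq> B"
    have "T (B \<inter> E G) \<subseteq> T (A \<inter> E G)"
      using AB chosen_substitutable[of "B \<inter> E G" "A \<inter> E G"] by (auto simp: T_def)
    then show "g A \<subseteq> g B" by (auto simp: g_def H_def best_def)
  qed
  then obtain A where A: "g A = A" using lfp_unfold by blast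
  then have AE: "A \<subseteq> E G" by (auto simp: g_def H_def)
  then have HA: "A = E G - (T A - best (T A))" using A by (simp add: g_def H_def Int_absorb2)
  define X where "X = chosen A"
  have XA: "X \<subseteq> A" using chosen_subset by (auto simp: X_def)
  have TE: "T A \<subseteq> E G" by (auto simp: T_def)
  have Xb: "X = best (T A)"
  proof -
    have "X = A \<inter> T A" using AE XA by (auto simp: T_def X_def)
    also have "\<dots> = best (T A)" using HA TE by (auto simp: best_def)
    finally show ?thesis .
  qed
  have inj: "inj_on fst X"
    using better_total TE unfolding Xb best_def inj_on_def by blast
  have "upper X \<subseteq> A"
  proof (rule ccontr)
    assume "\<not> upper X \<subseteq> A"
    then obtain e where e: "e \<in> upper X" "e \<notin> A" by blast
    then have eT: "e \<in> T A" using HA upper_subset by blast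
    define K where "K = {e' \<in> T A. better e' e}"
    have "e \<notin> best (T A)" using e HA eT TE by blast
    then have K: "K \<noteq> {}" using eT by (auto simp: K_def best_def)
    have "K \<subseteq> E G" "\<And>e' e''. e' \<in> K \<Longrightarrow> e'' \<in> K \<Longrightarrow> fst e' = fst e''"
      using TE by (auto simp: K_def better_def)
    from ex_best[OF this(1) K this(2)]
    obtain m where m: "m \<in> K" "\<forall>b\<in>K. b = m \<or> better m b" by blast
    have "\<not> better b m" if b: "b \<in> T A" for b
    proof
      assume bm: "better b m"
      then have "b \<in> K" using m(1) b better_trans[OF bm] by (simp add: K_def)
      then have "b = m \<or> better m b" using m(2) by blast
      then show False using bm better_irrefl better_asym by metis
    qed
    then have "m \<in> best (T A)" using m unfolding K_def best_def by blast
    then show False using e m Xb by (auto simp: upper_def K_def)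
  qed
  then have "chosen (upper X) = X"
    using chosen_consistent[OF AE, of "upper X"] subset_upper[OF _ inj] XA AE by (auto simp: X_def)
  moreover have "X \<subseteq> E G" using XA AE by blast
  ultimately have "stable G X" using inj stable_iff[of X] by simp
  then show ?thesis ..
qed

section \<open>Tandems and the active graph\<close>

lemma W_admissible_unique:
  assumes "W_admissible G X a" "W_admissible G X a'" "fst a = fst a'"
  shows "a = a'"
proof (rule ccontr)
  assume "a \<noteq> a'"
  moreover have cand: "a \<in> W_candidates G X (fst a)" "a' \<in> W_candidates G X (fst a)"
    using assms by (auto simp: W_admissible_def choiceW_def)
  ultimately have "gt G (fst a) a a'" "gt G (fst a) a' a"
    using assms unfolding W_admissible_def choiceW_def by auto
  moreover have "a \<in> E G" "a' \<in> E G" using cand by (auto simp: W_candidates_def atW_def)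
  ultimately have "better a a'" "better a' a" using assms(3) by (auto simp: better_def)
  then show False using better_asym by blast
qed

lemma W_candidates_iff:
  assumes "stable G X"
  shows "e \<in> W_candidates G X w \<longleftrightarrow>
    fst e = w \<and> (\<exists>x\<in>X. better x e) \<and> e \<in> chosen (insert e X)"
proof -
  have "atF (insert e X) (snd e) = atF X (snd e) \<union> {e}" by (auto simp: atF_def)
  then have 1: "e \<in> chosen (insert e X) \<longleftrightarrow> e \<in> choiceF G (snd e) (atF X (snd e) \<union> {e})"
    by (simp add: chosen_def)
  have 2: "atW X w = {x} \<longleftrightarrow> x \<in> X \<and> fst x = w" for x
    using stable_inj[OF assms] unfolding atW_def inj_on_def by blast
  show ?thesis
    unfolding W_candidates_def 1 2
    using stable_subset[OF assms] by (auto simp: better_def atW_def)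
qed

lemma W_admissible_iff:
  assumes "stable G X"
  shows "W_admissible G X a \<longleftrightarrow> (\<exists>x\<in>X. better x a) \<and> a \<in> chosen (insert a X) \<and>
    (\<forall>e. fst e = fst a \<and> (\<exists>x\<in>X. better x e) \<and> e \<in> chosen (insert e X) \<longrightarrow> e = a \<or> better a e)"
proof -
  have "gt G (fst a) a e \<longleftrightarrow> better a e" if "better x a" "better x' e" "fst e = fst a" for x x' e
    using that by (auto simp: better_def)
  moreover have "fst a \<in> WV G" if "better x a" for x
    using that edge_ends[of a] by (auto simp: better_def)
  ultimately show ?thesis
    unfolding W_admissible_def choiceW_def mem_Collect_eq W_candidates_iff[OF assms] Ball_def
    by (metis (no_types, lifting))
qed

lemma W_admissible_not_in:
  assumes "stable G X" "W_admissible G X a"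
  shows "a \<notin> X"
  using assms stable_subset_upper[OF assms(1)] unfolding W_admissible_iff[OF assms(1)] upper_def
  by blast

lemma W_admissible_in_E: "stable G X \<Longrightarrow> W_admissible G X a \<Longrightarrow> a \<in> E G"
  unfolding W_admissible_iff better_def by blast

text \<open>Adding \<open>a\<close> changes the choice only at its own end in \<open>F\<close>, so tandems can be read off the joint
  choice function.\<close>

lemma tandem_iff:
  assumes X: "stable G X"
  shows "tandem G X a b \<longleftrightarrow>
    W_admissible G X a \<and> b \<in> X \<and> chosen (insert a X) = insert a (X - {b})"
proof (cases "W_admissible G X a")
  case True
  have aX: "a \<notin> X" and aE: "a \<in> E G" using W_admissible_not_in W_admissible_in_E X True by blast+
  then have fa: "snd a \<in> FV G" and sub: "insert a X \<subseteq> E G"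
    using edge_ends stable_subset[OF X] by blast+
  have at_a: "atF (insert a X) (snd a) = atF X (snd a) \<union> {a}" by (auto simp: atF_def)
  have other: "atF (chosen (insert a X)) f = atF X f" if f: "f \<in> FV G" "f \<noteq> snd a" for f
  proof -
    have "atF (insert a X) f = atF X f" using f by (auto simp: atF_def)
    then show ?thesis
      using atF_chosen[OF sub f(1)] atF_chosen[OF stable_subset[OF X] f(1)] stable_chosen[OF X]
      by simp
  qed
  have rhs: "b \<in> atF X (snd a) \<Longrightarrow> f \<noteq> snd a \<Longrightarrow> atF (insert a (X - {b})) f = atF X f" for f
    by (auto simp: atF_def)
  have rhs_a: "atF (insert a (X - {b})) (snd a) = (atF X (snd a) - {b}) \<union> {a}"
    by (auto simp: atF_def)
  have same_end: "snd b = snd a" if b: "b \<in> X" "chosen (insert a X) = insert a (X - {b})"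
  proof (rule ccontr)
    assume ne: "snd b \<noteq> snd a"
    have "snd b \<in> FV G" using b(1) stable_subset[OF X] edge_ends by blast
    from other[OF this ne] have "b \<in> chosen (insert a X)" using b(1) by (auto simp: atF_def)
    then show False using b aX by auto
  qed
  show ?thesis
  proof
    assume t: "tandem G X a b"
    then have b: "b \<in> atF X (snd a)" and
      c: "choiceF G (snd a) (atF X (snd a) \<union> {a}) = (atF X (snd a) - {b}) \<union> {a}"
      by (auto simp: tandem_def)
    have "chosen (insert a X) = insert a (X - {b})"
    proof (rule eq_if_atF_eq)
      fix f assume f: "f \<in> FV G"
      show "atF (chosen (insert a X)) f = atF (insert a (X - {b})) f"
        using other[OF f] rhs[OF b, of f] rhs_a c at_a atF_chosen[OF sub fa] by (cases "f = snd a") auto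
    qed (use chosen_subset sub in blast)+
    then show "W_admissible G X a \<and> b \<in> X \<and> chosen (insert a X) = insert a (X - {b})"
      using True b by (auto simp: atF_def)
  next
    assume r: "W_admissible G X a \<and> b \<in> X \<and> chosen (insert a X) = insert a (X - {b})"
    then have "choiceF G (snd a) (atF X (snd a) \<union> {a}) = (atF X (snd a) - {b}) \<union> {a}"
      using atF_chosen[OF sub fa] at_a rhs_a by simp
    then show "tandem G X a b" using r same_end by (auto simp: tandem_def atF_def)
  qed
qed (auto simp: tandem_def)

lemma tandem_unique:
  assumes "stable G X" "tandem G X a b" "tandem G X a b'"
  shows "b = b'"
proof (rule ccontr)
  assume ne: "b \<noteq> b'"
  note t = assms(2,3)[unfolded tandem_iff[OF assms(1)]]
  have "insert a (X - {b}) = insert a (X - {b'})" using t by simp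
  moreover have "b \<in> insert a (X - {b'})" using t ne by blast
  ultimately have "b = a" by blast
  then show False using t W_admissible_not_in[OF assms(1), of a] by blast
qed

definition tandem_ends :: "('w, 'f) edge set \<Rightarrow> ('w, 'f) edge set \<Rightarrow> ('w, 'f) edge set" where
  "tandem_ends X P = {b. \<exists>a\<in>P. tandem G X a b}"

text \<open>The \<open>W\<close>-to-\<open>F\<close> part of the active graph is the largest such set; this is why the result
  of cleaning does not depend on the order of the steps.\<close>

definition self_supporting :: "('w, 'f) edge set \<Rightarrow> ('w, 'f) edge set \<Rightarrow> bool" where
  "self_supporting X Q \<longleftrightarrow> Q \<subseteq> {a. W_admissible G X a} \<and> fst ` Q \<subseteq> fst ` tandem_ends X Q"

text \<open>Each cleaning step keeps the edges from \<open>F\<close> to \<open>W\<close> determined by those from \<open>W\<close> to \<open>F\<close>,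
  and it can never delete an edge of a self-supporting set.\<close>

lemma clean_reachable:
  assumes "(clean_step G X)\<^sup>*\<^sup>* (D_graph G X) H"
  shows "fst H \<subseteq> {a. W_admissible G X a} \<and> snd H = tandem_ends X (fst H) \<and>
    (\<forall>Q. self_supporting X Q \<longrightarrow> Q \<subseteq> fst H)"
  using assms
proof (induction rule: rtranclp_induct)
  case base
  show ?case
    by (auto simp: D_graph_def tandem_ends_def F_admissible_def self_supporting_def tandem_def)
next
  case (step H H')
  from step(2) obtain a P M where H: "H = (P, M)" and a: "a \<in> P" "\<forall>b \<in> M. fst b \<noteq> fst a" and
    H': "H' = (P - {a}, M - {b. tandem G X a b \<and> \<not> (\<exists>a' \<in> P. a' \<noteq> a \<and> tandem G X a' b)})"
    by (cases rule: clean_step.cases) blast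
  have M: "M = tandem_ends X P" using step(3) H by simp
  have "a \<notin> Q" if Q: "self_supporting X Q" for Q
  proof
    assume "a \<in> Q"
    then have "fst a \<in> fst ` tandem_ends X Q" using Q unfolding self_supporting_def by blast
    moreover have "tandem_ends X Q \<subseteq> M"
      using step(3) Q H unfolding M tandem_ends_def by fastforce
    ultimately show False using a(2) by (metis imageE subsetD)
  qed
  moreover have "snd H' = tandem_ends X (fst H')"
    using a(1) unfolding H' M tandem_ends_def by auto
  ultimately show ?case using step(3) H H' by (simp add: subset_Diff_insert) blast
qed

text \<open>A terminal graph is self-supporting and contains every self-supporting set, hence there is
  only one; one exists since each step deletes an edge.\<close>

lemma active_graph_reachable:
  "(clean_step G X)\<^sup>*\<^sup>* (D_graph G X) (active_graph G X)"
proof -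
  let ?final = "\<lambda>H. (clean_step G X)\<^sup>*\<^sup>* (D_graph G X) H \<and> (\<nexists>H'. clean_step G X H H')"
  have "{a. W_admissible G X a} \<subseteq> E G"
    by (auto simp: W_admissible_def choiceW_def W_candidates_def atW_def)
  then have fin: "finite {a. W_admissible G X a}" using finite_E finite_subset by blast
  obtain H where H: "(clean_step G X)\<^sup>*\<^sup>* (D_graph G X) H"
    and least: "\<And>H'. (clean_step G X)\<^sup>*\<^sup>* (D_graph G X) H' \<Longrightarrow> card (fst H) \<le> card (fst H')"
    using ex_has_least_nat[of "(clean_step G X)\<^sup>*\<^sup>* (D_graph G X)" "D_graph G X" "\<lambda>H. card (fst H)"]
    by blast
  have "?final H"
  proof (intro conjI notI H)
    assume "\<exists>H'. clean_step G X H H'"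
    then obtain H' where st: "clean_step G X H H'" by blast
    then have "fst H' \<subset> fst H" by (cases rule: clean_step.cases) auto
    moreover have "finite (fst H)" using clean_reachable[OF H] fin finite_subset by blast
    ultimately have "card (fst H') < card (fst H)" using psubset_card_mono by blast
    then show False using least[OF rtranclp.rtrancl_into_rtrancl[OF H st]] by simp
  qed
  moreover have "H1 = H2" if f: "?final H1" "?final H2" for H1 H2
  proof -
    have ss: "self_supporting X (fst H)" if "?final H" for H
    proof -
      obtain P M where PM: "H = (P, M)" by force
      have r: "P \<subseteq> {a. W_admissible G X a}" "M = tandem_ends X P"
        using clean_reachable[of X H] that PM by auto
      have "\<exists>b\<in>M. fst b = fst a" if a: "a \<in> P" for a
        using clean_step.intros[OF a, of M G X] \<open>?final H\<close> PM by blast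
      then have "fst ` P \<subseteq> fst ` M" by (metis image_eqI image_subsetI)
      then show ?thesis using r PM by (simp add: self_supporting_def)
    qed
    then have "fst H1 = fst H2" using f clean_reachable by (metis subset_antisym)
    then show ?thesis using clean_reachable f by (metis prod_eqI)
  qed
  ultimately have "\<exists>!H. ?final H" by blast
  from theI'[OF this] show ?thesis unfolding active_graph_def by blast
qed

lemma self_supporting_active:
  assumes "self_supporting X Q"
  shows "Q \<subseteq> fst (active_graph G X)" "tandem_ends X Q \<subseteq> snd (active_graph G X)"
proof -
  note r = clean_reachable[OF active_graph_reachable, of X]
  show Q: "Q \<subseteq> fst (active_graph G X)" using r assms by blast
  show "tandem_ends X Q \<subseteq> snd (active_graph G X)"
    using r Q unfolding tandem_ends_def by fastforce
qed

section \<open>Rotations are the covering steps of the ring of sets\<close>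

lemma generated_rotation_facts:
  assumes "L \<in> generated_rotations G X"
  shows "fst L \<noteq> {}" "\<And>a. a \<in> fst L \<Longrightarrow> W_admissible G X a" "snd L \<subseteq> X"
    "fst ` fst L = fst ` snd L" "card (fst L) = card (snd L)"
    "\<And>b. b \<in> snd L \<Longrightarrow> \<exists>a\<in>fst L. tandem G X a b"
proof -
  obtain ts where L: "L = (set (map fst ts), set (map snd ts))" and ts: "tandem_cycle G X ts"
    using assms by (auto simp: generated_rotations_def)
  let ?n = "length ts"
  have n: "?n > 0" and d: "distinct (map fst ts)" "distinct (map snd ts)" and
    tan: "\<And>p. p \<in> set ts \<Longrightarrow> tandem G X (fst p) (snd p)" and
    cyc: "\<And>i. i < ?n \<Longrightarrow> fst (snd (ts ! i)) = fst (fst (ts ! (Suc i mod ?n)))"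
    using ts by (auto simp: tandem_cycle_def)
  show "fst L \<noteq> {}" using n L by auto
  show "W_admissible G X a" if "a \<in> fst L" for a
    using that tan L by (auto simp: tandem_def)
  show "snd L \<subseteq> X" using tan L by (auto simp: tandem_def atF_def)
  show "card (fst L) = card (snd L)" using distinct_card[OF d(1)] distinct_card[OF d(2)] L by simp
  show "\<exists>a\<in>fst L. tandem G X a b" if "b \<in> snd L" for b
    using that tan L by force
  show "fst ` fst L = fst ` snd L"
  proof
    show "fst ` snd L \<subseteq> fst ` fst L"
    proof
      fix w assume "w \<in> fst ` snd L"
      then obtain i where i: "i < ?n" "w = fst (snd (ts ! i))" using L by (auto simp: in_set_conv_nth)
      then have "ts ! (Suc i mod ?n) \<in> set ts" using n by simp
      then show "w \<in> fst ` fst L" using cyc[OF i(1)] i(2) L by auto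
    qed
    show "fst ` fst L \<subseteq> fst ` snd L"
    proof
      fix w assume "w \<in> fst ` fst L"
      then obtain j where j: "j < ?n" "w = fst (fst (ts ! j))" using L by (auto simp: in_set_conv_nth)
      define i where "i = (j + ?n - 1) mod ?n"
      have i: "i < ?n" using n by (simp add: i_def)
      have "Suc i mod ?n = Suc (j + ?n - 1) mod ?n" unfolding i_def by (rule mod_Suc_eq)
      also have "\<dots> = j" using n j by simp
      finally have "w = fst (snd (ts ! i))" using cyc[OF i] j by simp
      then show "w \<in> fst ` snd L" using i L by auto
    qed
  qed
qed

text \<open>A rotation is the orbit of any of its edges under the map that follows a tandem and then
  the admissible edge at the vertex reached.\<close>

lemma tandem_cycle_subset:
  assumes X: "stable G X" and ts: "tandem_cycle G X ts" "tandem_cycle G X ts'"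
    and p: "p \<in> set ts" "p' \<in> set ts'" "fst p = fst p'"
  shows "set ts \<subseteq> set ts'"
proof -
  let ?n = "length ts" and ?m = "length ts'"
  have n: "?n > 0" "?m > 0" using ts by (auto simp: tandem_cycle_def)
  have tan: "tandem G X (fst q) (snd q)" if "q \<in> set ts \<union> set ts'" for q
    using ts that by (auto simp: tandem_cycle_def)
  have cyc: "fst (snd (us ! i)) = fst (fst (us ! (Suc i mod length us)))"
    if "i < length us" "us \<in> {ts, ts'}" for us i
    using ts that by (auto simp: tandem_cycle_def)
  have eq: "q = q'" if "q \<in> set ts" "q' \<in> set ts'" "fst (fst q) = fst (fst q')" for q q'
  proof -
    have "fst q = fst q'" using W_admissible_unique[of X "fst q" "fst q'"] that tan[of q] tan[of q']
      by (auto simp: tandem_def)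
    moreover from this have "snd q = snd q'"
      using tandem_unique[OF X, of "fst q" "snd q" "snd q'"] that tan[of q] tan[of q'] by simp
    ultimately show ?thesis by (simp add: prod_eq_iff)
  qed
  obtain i where i: "i < ?n" "ts ! i = p" using p by (auto simp: in_set_conv_nth)
  obtain j where j: "j < ?m" "ts' ! j = p'" using p by (auto simp: in_set_conv_nth)
  have same: "ts ! ((i + k) mod ?n) = ts' ! ((j + k) mod ?m)" for k
  proof (induction k)
    case 0
    then show ?case using eq[OF p(1,2)] p(3) i j by simp
  next
    case (Suc k)
    let ?i = "(i + k) mod ?n" and ?j = "(j + k) mod ?m"
    have "?i < ?n" "?j < ?m" using n by simp_all
    then have "fst (fst (ts ! (Suc ?i mod ?n))) = fst (fst (ts' ! (Suc ?j mod ?m)))"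
      using cyc[of ?i ts] cyc[of ?j ts'] Suc by simp
    then have "ts ! (Suc ?i mod ?n) = ts' ! (Suc ?j mod ?m)"
      using n by (intro eq) simp_all
    then show ?case by (simp add: mod_Suc_eq)
  qed
  show ?thesis
  proof
    fix q assume "q \<in> set ts"
    then obtain l where l: "l < ?n" "ts ! l = q" by (auto simp: in_set_conv_nth)
    have "(i + (l + ?n - i)) mod ?n = l" using i l by simp
    then have "q = ts' ! ((j + (l + ?n - i)) mod ?m)" using same[of "l + ?n - i"] l by simp
    then show "q \<in> set ts'" using n by simp
  qed
qed

lemma rotation_eq_if_common_edge:
  assumes X: "stable G X" and L: "L \<in> generated_rotations G X" "L' \<in> generated_rotations G X"
    and a: "a \<in> fst L" "a \<in> fst L'"
  shows "L = L'"
proof -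
  obtain ts where ts: "L = (set (map fst ts), set (map snd ts))" "tandem_cycle G X ts"
    using L by (auto simp: generated_rotations_def)
  obtain ts' where ts': "L' = (set (map fst ts'), set (map snd ts'))" "tandem_cycle G X ts'"
    using L by (auto simp: generated_rotations_def)
  obtain p p' where p: "p \<in> set ts" "p' \<in> set ts'" "fst p = fst p'"
    using a ts(1) ts'(1) by fastforce
  have "set ts = set ts'"
    using tandem_cycle_subset[OF X ts(2) ts'(2) p] tandem_cycle_subset[OF X ts'(2) ts(2) p(2,1)] p(3)
    by simp
  then show ?thesis using ts(1) ts'(1) by simp
qed

text \<open>At each vertex \<open>w\<close> of \<open>L\<close> this is the preference interval from just below the edge of \<open>L\<^sup>-\<close>
  down to the edge of \<open>L\<^sup>+\<close>.\<close>

definition block :: "('w, 'f) rotation \<Rightarrow> ('w, 'f) edge set" where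
  "block L = {e. (\<exists>b\<in>snd L. better b e) \<and> (\<exists>a\<in>fst L. fst a = fst e \<and> \<not> better a e)}"

text \<open>Let \<open>x\<^sub>w\<close> and \<open>a\<^sub>w\<close> be the edges of \<open>L\<^sup>-\<close> and \<open>L\<^sup>+\<close> at \<open>w\<close>. Only edges strictly between \<open>x\<^sub>w\<close> and \<open>a\<^sub>w\<close> and the edges of \<open>L\<^sup>+\<close> are newly offered to the
  \<open>F\<close>-side. The former are refused by the choice of \<open>a\<^sub>w\<close>, the edges of \<open>L\<^sup>-\<close> are refused because
  of their tandems, and by monotonicity of cardinality nothing else can be refused.\<close>

lemma
  assumes X: "stable G X" and L: "L \<in> generated_rotations G X"
  shows stable_apply_rotation: "stable G (apply_rotation L X)"
    and upper_apply_rotation: "upper (apply_rotation L X) = upper X \<union> block L"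
    and block_disjoint: "upper X \<inter> block L = {}"
    and rotation_subset_block: "fst L \<subseteq> block L"
    and rotation_fresh: "fst L \<inter> X = {}"
proof -
  note facts = generated_rotation_facts[OF L]
  let ?P = "fst L" and ?N = "snd L" and ?X' = "apply_rotation L X"
  have X': "?X' = (X - ?N) \<union> ?P" by (simp add: apply_rotation_def)
  have XE: "X \<subseteq> E G" using stable_subset[OF X] .
  have PE: "?P \<subseteq> E G" using facts(2) W_admissible_in_E[OF X] by blast
  have NE: "?N \<subseteq> E G" using facts(3) XE by blast
  show fresh: "?P \<inter> X = {}" using facts(2) W_admissible_not_in[OF X] by blast
  have X'E: "?X' \<subseteq> E G" using X' XE PE by blast
  have injX: "x = y" if "x \<in> X" "y \<in> X" "fst x = fst y" for x y
    using stable_inj[OF X] that by (meson inj_onD)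
  have injP: "x = y" if "x \<in> ?P" "y \<in> ?P" "fst x = fst y" for x y
    using W_admissible_unique facts(2) that by blast
  have toN: "\<exists>b\<in>?N. fst b = fst a" if "a \<in> ?P" for a
    using facts(4) that by (metis image_iff)
  have toP: "\<exists>a\<in>?P. fst a = fst b" if "b \<in> ?N" for b
    using facts(4) that by (metis image_iff)
  have worse: "better b a" if ab: "b \<in> ?N" "a \<in> ?P" "fst b = fst a" for a b
  proof -
    obtain x where "x \<in> X" "better x a"
      using facts(2)[OF ab(2)] unfolding W_admissible_iff[OF X] by blast
    then show ?thesis using injX[of x b] ab facts(3) better_fst[of x a] by auto
  qed
  show "?P \<subseteq> block L"
  proof
    fix a assume a: "a \<in> ?P"
    then obtain b where "b \<in> ?N" "fst b = fst a" using toN by blast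
    then show "a \<in> block L" using worse a better_irrefl[of a] unfolding block_def by blast
  qed
  have inj': "inj_on fst ?X'"
  proof -
    have mixed: False if "x \<in> X - ?N" "y \<in> ?P" "fst x = fst y" for x y
      using toN[OF that(2)] injX[of x] facts(3) that by (metis DiffD1 DiffD2 subsetD)
    show ?thesis
    proof (rule inj_onI)
      fix x y assume "x \<in> ?X'" "y \<in> ?X'" "fst x = fst y"
      then show "x = y" using mixed[of x y] mixed[of y x] injX[of x y] injP[of x y] X' by auto
    qed
  qed
  show disj: "upper X \<inter> block L = {}"
    using facts(3) unfolding block_def upper_def by blast
  show up: "upper ?X' = upper X \<union> block L"
  proof
    show "upper ?X' \<subseteq> upper X \<union> block L"
    proof
      fix e assume e: "e \<in> upper ?X'"
      then have eE: "e \<in> E G" using upper_subset by blast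
      show "e \<in> upper X \<union> block L"
      proof (cases "e \<in> upper X")
        case False
        then obtain x where x: "x \<in> X" "better x e" "fst x = fst e" using not_upperE[OF eE] by blast
        then have "x \<in> ?N" using e unfolding X' upper_def by blast
        moreover obtain a where a: "a \<in> ?P" "fst a = fst x" using toP[OF \<open>x \<in> ?N\<close>] by blast
        moreover have "\<not> better a e" using e a(1) unfolding X' upper_def by blast
        ultimately show ?thesis using x unfolding block_def by auto
      qed blast
    qed
    show "upper X \<union> block L \<subseteq> upper ?X'"
    proof
      fix e assume e: "e \<in> upper X \<union> block L"
      then have eE: "e \<in> E G" unfolding upper_def block_def better_def by blast
      have "\<not> better z e" if z: "z \<in> ?X'" for z
      proof
        assume ze: "better z e"
        show False
        proof (cases "e \<in> upper X")
          case True
          then have "z \<in> ?P" using z ze unfolding X' upper_def by blast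
          then obtain b where b: "b \<in> ?N" "fst b = fst z" using toN by blast
          then have "better b e" using worse \<open>z \<in> ?P\<close> ze better_trans by blast
          then show False using True b facts(3) unfolding upper_def by blast
        next
          case False
          then obtain b a where b: "b \<in> ?N" "better b e" and a: "a \<in> ?P" "fst a = fst e" "\<not> better a e"
            using e unfolding block_def by blast
          have "a \<in> ?X'" using a X' by blast
          then have "z = a" using inj_onD[OF inj'] z better_fst[OF ze] a by simp
          then show False using a ze by blast
        qed
      qed
      then show "e \<in> upper ?X'" using eE unfolding upper_def by blast
    qed
  qed
  \<comment> \<open>Without \<open>L\<^sup>+\<close> the \<open>F\<close>-side still chooses \<open>X\<close>; this gives the lower bound on cardinality.\<close>
  define D where "D = upper ?X' - ?P"
  have uE: "upper ?X' \<subseteq> E G" by (rule upper_subset)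
  have XU: "X \<subseteq> upper ?X'" using up stable_subset_upper[OF X] by blast
  have XD: "X \<subseteq> D" using XU fresh unfolding D_def by blast
  have PU: "?P \<subseteq> upper ?X'" using subset_upper[OF X'E inj'] X' by blast
  have refused: "e \<notin> chosen (insert e X)" if e: "e \<in> D - X" for e
  proof (cases "e \<in> upper X")
    case True
    then have "chosen (insert e X) = X"
      using stable_chosen_between[OF X, of "insert e X"] stable_subset_upper[OF X] by blast
    then show ?thesis using e by blast
  next
    case False
    then obtain b a where b: "b \<in> ?N" "better b e" and a: "a \<in> ?P" "fst a = fst e" "\<not> better a e"
      using e up unfolding D_def block_def by blast
    have "e \<noteq> a" using a e unfolding D_def by blast
    then show ?thesis
      using facts(2)[OF a(1)] a b facts(3) unfolding W_admissible_iff[OF X] by (metis subsetD)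
  qed
  have DE: "D \<subseteq> E G" using uE unfolding D_def by blast
  have chD: "chosen D = X" using chosen_eqI[OF XD DE stable_chosen[OF X] refused] .
  have sub: "chosen (upper ?X') \<subseteq> ?X'"
  proof
    fix e assume e: "e \<in> chosen (upper ?X')"
    then have eu: "e \<in> upper ?X'" using chosen_subset by blast
    have "e \<in> chosen (insert e X)"
      using chosen_substitutable[OF uE _ e, of "insert e X"] eu XU by blast
    then have "e \<in> X \<union> ?P" using refused eu unfolding D_def by blast
    moreover have "e \<notin> ?N"
    proof
      assume "e \<in> ?N"
      then obtain a where a: "a \<in> ?P" "tandem G X a e" using facts(6) by blast
      have eX: "e \<in> X" using \<open>e \<in> ?N\<close> facts(3) by blast
      have "insert a X \<subseteq> upper ?X'" using a(1) PU XU by blast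
      from chosen_substitutable[OF uE this e] have "e \<in> chosen (insert a X)" using eX by simp
      then have "e \<in> insert a (X - {e})" using a(2) tandem_iff[OF X] by simp
      then show False using a(1) fresh eX by blast
    qed
    ultimately show "e \<in> ?X'" using X' by blast
  qed
  have "card ?X' \<le> card (chosen (upper ?X'))"
  proof -
    have finX: "finite X" using stable_finite[OF X] .
    have finP: "finite ?P" using PE finite_E finite_subset by blast
    have "card ?X' = card (X - ?N) + card ?P"
      unfolding X' using card_Un_disjoint[of "X - ?N" ?P] finX finP fresh by blast
    also have "\<dots> = card X"
      using facts(3,5) finX card_mono[OF finX facts(3)]
        card_Diff_subset[OF finite_subset[OF facts(3) finX] facts(3)] by simp
    also have "\<dots> \<le> card (chosen (upper ?X'))"
      using card_chosen_mono[OF uE, of D] chD unfolding D_def by simp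
    finally show ?thesis .
  qed
  then have "chosen (upper ?X') = ?X'"
    using card_seteq[OF _ sub] finite_subset[OF X'E finite_E] by blast
  then show "stable G ?X'" using stable_iff[of ?X'] X'E inj' by simp
qed

lemma cycle_exists:
  fixes \<sigma> :: "'c \<Rightarrow> 'c"
  assumes "finite M" "M \<noteq> {}" "\<And>w. w \<in> M \<Longrightarrow> \<sigma> w \<in> M"
  obtains w n where "w \<in> M" "0 < n" "(\<sigma> ^^ n) w = w" "inj_on (\<lambda>i. (\<sigma> ^^ i) w) {..<n}"
proof -
  have closed: "(\<sigma> ^^ i) w \<in> M" if "w \<in> M" for i w
    using that assms(3) by (induction i) auto
  let ?per = "\<lambda>n. 0 < n \<and> (\<exists>w\<in>M. (\<sigma> ^^ n) w = w)"
  have shift: "?per (j - i)" if "w \<in> M" "i < j" "(\<sigma> ^^ i) w = (\<sigma> ^^ j) w" for w i j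
  proof -
    have "(\<sigma> ^^ (j - i)) ((\<sigma> ^^ i) w) = (\<sigma> ^^ (j - i + i)) w" by (simp only: funpow_add o_apply)
    then show ?thesis using that closed[OF that(1), of i] by auto
  qed
  obtain w0 where w0: "w0 \<in> M" using assms(2) by blast
  have "\<not> inj (\<lambda>i. (\<sigma> ^^ i) w0)"
  proof
    assume "inj (\<lambda>i. (\<sigma> ^^ i) w0)"
    moreover have "finite (range (\<lambda>i. (\<sigma> ^^ i) w0))"
      using closed[OF w0] assms(1) by (meson finite_subset image_subsetI)
    ultimately show False using finite_imageD infinite_UNIV_nat by blast
  qed
  then obtain i j where ij: "i \<noteq> j" "(\<sigma> ^^ i) w0 = (\<sigma> ^^ j) w0" by (auto simp: inj_on_def)
  have ex: "\<exists>n. ?per n"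
  proof (cases "i < j")
    case True
    then show ?thesis using shift[OF w0 True ij(2)] by blast
  next
    case False
    then have "j < i" using ij(1) by simp
    then show ?thesis using shift[OF w0 _ ij(2)[symmetric]] by blast
  qed
  define n where "n = (LEAST n. ?per n)"
  have n: "?per n" unfolding n_def by (rule LeastI_ex[OF ex])
  then obtain w where w: "w \<in> M" "(\<sigma> ^^ n) w = w" by blast
  have ne: "(\<sigma> ^^ i) w \<noteq> (\<sigma> ^^ j) w" if "i < j" "j < n" for i j
  proof
    assume "(\<sigma> ^^ i) w = (\<sigma> ^^ j) w"
    then have "?per (j - i)" using shift[OF w(1) that(1)] by blast
    then have "n \<le> j - i" unfolding n_def by (rule Least_le)
    then show False using that by simp
  qed
  have "inj_on (\<lambda>i. (\<sigma> ^^ i) w) {..<n}"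
  proof (rule inj_onI)
    fix i j assume "i \<in> {..<n}" "j \<in> {..<n}" "(\<sigma> ^^ i) w = (\<sigma> ^^ j) w"
    then show "i = j" using ne[of i j] ne[of j i] by (cases i j rule: linorder_cases) auto
  qed
  then show ?thesis using that n w by blast
qed

text \<open>At each matched \<open>w\<close> where \<open>X\<close> and \<open>Y\<close> differ the edge of \<open>Y\<close> is a candidate, so \<open>a\<^sub>w\<close> exists and is
  at least as good for \<open>w\<close>. It has a tandem, since otherwise \<open>F\<close> would choose more than \<open>|Y|\<close>
  edges from a subset of \<open>upper Y\<close>, and the edge it releases is not in \<open>Y\<close>. Thus the walk
  along tandems stays among such \<open>w\<close>, and being in a finite set it closes up to a rotation.\<close>

lemma rotation_towards:
  assumes X: "stable G X" and Y: "stable G Y" and sub: "upper X \<subseteq> upper Y" and ne: "X \<noteq> Y"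
  obtains L where "L \<in> generated_rotations G X" "upper (apply_rotation L X) \<subseteq> upper Y"
proof -
  define M where "M = fst ` (X - Y)"
  have XY: "X \<subseteq> upper Y" using stable_subset_upper[OF X] sub by blast
  have injX: "x = y" if "x \<in> X" "y \<in> X" "fst x = fst y" for x y
    using stable_inj[OF X] that by (meson inj_onD)
  have injY: "x = y" if "x \<in> Y" "y \<in> Y" "fst x = fst y" for x y
    using stable_inj[OF Y] that by (meson inj_onD)
  have finM: "finite M" using stable_finite[OF X] by (simp add: M_def)
  have M0: "M \<noteq> {}"
  proof
    assume "M = {}"
    then have "X \<subseteq> Y" by (auto simp: M_def)
    then show False using card_subset_eq[OF stable_finite[OF Y]] stable_card_eq[OF X Y] ne by blast
  qed
  have "\<exists>a b. tandem G X a b \<and> fst a = w \<and> a \<in> upper Y \<and> fst b \<in> M" if w: "w \<in> M" for w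
  proof -
    obtain x where x: "x \<in> X" "x \<notin> Y" "fst x = w" using w by (auto simp: M_def)
    have "w \<in> fst ` Y" using conjunct1[OF stable_join_matched[OF X Y]] x by blast
    then obtain y where y: "y \<in> Y" "fst y = w" by blast
    have yE: "y \<in> E G" and xE: "x \<in> E G" using y x stable_subset X Y by blast+
    have yu: "y \<in> upper Y" using stable_subset_upper[OF Y] y by blast
    have "\<not> better y x" using x y XY unfolding upper_def by blast
    then have xy: "better x y" using better_total[OF xE yE] x y by auto
    have "y \<in> chosen (upper Y)" using y stable_chosen_upper[OF Y] by simp
    moreover have "insert y X \<subseteq> upper Y" using yu XY by blast
    ultimately have ych: "y \<in> chosen (insert y X)"
      using chosen_substitutable[OF upper_subset] by blast
    define K where "K = {e. fst e = w \<and> (\<exists>x\<in>X. better x e) \<and> e \<in> chosen (insert e X)}"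
    have "K \<subseteq> E G" unfolding K_def better_def by blast
    moreover have yK: "y \<in> K" using y x xy ych unfolding K_def by blast
    then have "K \<noteq> {}" by blast
    moreover have "fst e = fst e'" if "e \<in> K" "e' \<in> K" for e e' using that by (simp add: K_def)
    ultimately have "\<exists>m\<in>K. \<forall>e\<in>K. e = m \<or> better m e" by (rule ex_best)
    then obtain a where a: "a \<in> K" "\<forall>e\<in>K. e = a \<or> better a e" by blast
    have aw: "fst a = w" and ach: "a \<in> chosen (insert a X)" using a(1) by (simp_all add: K_def)
    have adm: "W_admissible G X a"
      unfolding W_admissible_iff[OF X] aw using a unfolding K_def by blast
    have aE: "a \<in> E G" and aX: "a \<notin> X"
      using W_admissible_in_E[OF X adm] W_admissible_not_in[OF X adm] by blast+
    have "y = a \<or> better a y" using a(2) yK by blast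
    then have "\<not> better y a" using better_asym better_irrefl by metis
    then have au: "a \<in> upper Y" using upperI[OF Y aE y(1)] y aw by simp
    let ?c = "chosen (insert a X)"
    have ins: "insert a X \<subseteq> upper Y" using au XY by blast
    have insE: "insert a X \<subseteq> E G" using aE stable_subset[OF X] by blast
    have "card ?c \<le> card Y"
      using card_chosen_mono[OF upper_subset ins] stable_chosen_upper[OF Y] by simp
    moreover have "card X \<le> card ?c"
      using card_chosen_mono[OF insE, of X] stable_chosen[OF X] by auto
    ultimately have cc: "card ?c = card X" using stable_card_eq[OF X Y] by simp
    have finX: "finite X" using stable_finite[OF X] .
    have "?c \<subseteq> insert a X" by (rule chosen_subset)
    then have "card (insert a X - ?c) = 1"
      using card_Diff_subset[of ?c "insert a X"] finite_subset[of ?c "insert a X"] finX cc aX by simp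
    then obtain b where b: "insert a X - ?c = {b}" by (rule card_1_singletonE)
    then have "b \<in> insert a X - ?c" by simp
    then have bX: "b \<in> X" and bc: "b \<notin> ?c" using ach by blast+
    have "?c = insert a X - {b}"
      using b \<open>?c \<subseteq> insert a X\<close> Diff_Diff_Int[of "insert a X" ?c] by (simp add: Int_absorb1)
    moreover have "a \<noteq> b" using bX aX by blast
    ultimately have "?c = insert a (X - {b})" by (simp add: insert_Diff_if)
    then have t: "tandem G X a b" using tandem_iff[OF X] adm bX by blast
    have "b \<notin> Y"
    proof
      assume "b \<in> Y"
      then have "b \<in> chosen (upper Y)" using stable_chosen_upper[OF Y] by simp
      from chosen_substitutable[OF upper_subset ins this] show False using bX bc by simp
    qed
    then show ?thesis using t aw au bX unfolding M_def by blast
  qed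
  then obtain A B where AB: "\<And>w. w \<in> M \<Longrightarrow> tandem G X (A w) (B w) \<and> fst (A w) = w \<and>
      A w \<in> upper Y \<and> fst (B w) \<in> M"
    by metis
  define \<sigma> where "\<sigma> w = fst (B w)" for w
  have \<sigma>M: "\<sigma> w \<in> M" if "w \<in> M" for w using AB[OF that] by (simp add: \<sigma>_def)
  obtain w n where w: "w \<in> M" and n: "0 < n" "(\<sigma> ^^ n) w = w"
    and inj: "inj_on (\<lambda>i. (\<sigma> ^^ i) w) {..<n}"
    by (rule cycle_exists[of M \<sigma>, OF finM M0 \<sigma>M])
  define v where "v i = (\<sigma> ^^ i) w" for i
  have vM: "v i \<in> M" for i using w \<sigma>M by (induction i) (auto simp: v_def)
  have tan: "tandem G X (A (v i)) (B (v i))" and fstA: "fst (A (v i)) = v i"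
    and Au: "A (v i) \<in> upper Y" for i using AB[OF vM[of i]] by blast+
  have Bv: "fst (B (v i)) = v (Suc i mod n)" if "i < n" for i
  proof -
    have "fst (B (v i)) = v (Suc i)" by (simp add: v_def \<sigma>_def)
    also have "\<dots> = v (Suc i mod n)"
      using that n by (cases "Suc i = n") (auto simp: v_def)
    finally show ?thesis .
  qed
  have inj_v: "i = j" if "i < n" "j < n" "v i = v j" for i j
    using inj that by (auto simp: inj_on_def v_def)
  have inj_suc: "i = j" if "i < n" "j < n" "Suc i mod n = Suc j mod n" for i j
    using that by (cases "Suc i = n"; cases "Suc j = n") auto
  define ts where "ts = map (\<lambda>i. (A (v i), B (v i))) [0..<n]"
  define Q where "Q = (\<lambda>i. A (v i)) ` {..<n}"
  have setA: "set (map fst ts) = Q" by (auto simp: ts_def Q_def)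
  have "fst a \<in> fst ` tandem_ends X Q" if aQ: "a \<in> Q" for a
  proof -
    obtain j where j: "j < n" "a = A (v j)" using aQ by (auto simp: Q_def)
    define i where "i = (j + n - 1) mod n"
    have i: "i < n" using n by (simp add: i_def)
    have "Suc i mod n = Suc (j + n - 1) mod n" unfolding i_def by (rule mod_Suc_eq)
    also have "\<dots> = j" using n j by simp
    finally have "fst a = fst (B (v i))" using Bv[OF i] fstA[of j] j by simp
    moreover have "B (v i) \<in> tandem_ends X Q" using tan[of i] i by (auto simp: tandem_ends_def Q_def)
    ultimately show ?thesis by blast
  qed
  then have ss: "self_supporting X Q"
    using tan by (auto simp: self_supporting_def Q_def tandem_def)
  have memb: "A (v i) \<in> fst (active_graph G X) \<and> B (v i) \<in> snd (active_graph G X)" if "i < n" for i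
  proof -
    have AQ: "A (v i) \<in> Q" using that by (simp add: Q_def)
    have "B (v i) \<in> tandem_ends X Q"
      unfolding tandem_ends_def by (intro CollectI bexI[of _ "A (v i)"] tan AQ)
    then show ?thesis
      using subsetD[OF self_supporting_active(1)[OF ss] AQ] subsetD[OF self_supporting_active(2)[OF ss]]
      by simp
  qed
  have dA: "inj_on (\<lambda>i. A (v i)) {..<n}"
  proof (rule inj_onI)
    fix i j assume ij: "i \<in> {..<n}" "j \<in> {..<n}" "A (v i) = A (v j)"
    have "v i = v j" using arg_cong[OF ij(3), of fst] unfolding fstA .
    then show "i = j" using inj_v[of i j] ij(1,2) by simp
  qed
  have dB: "inj_on (\<lambda>i. B (v i)) {..<n}"
  proof (rule inj_onI)
    fix i j assume ij: "i \<in> {..<n}" "j \<in> {..<n}" "B (v i) = B (v j)"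
    have "v (Suc i mod n) = v (Suc j mod n)"
      using arg_cong[OF ij(3), of fst] ij(1,2) by (simp add: Bv)
    then have "Suc i mod n = Suc j mod n" using inj_v[of "Suc i mod n" "Suc j mod n"] n(1) by simp
    then show "i = j" using inj_suc[of i j] ij(1,2) by simp
  qed
  have cyc: "tandem_cycle G X ts"
    unfolding tandem_cycle_def
  proof (intro conjI)
    show "ts \<noteq> []" using n by (simp add: ts_def)
    show "distinct (map fst ts)" "distinct (map snd ts)"
      using dA dB by (auto simp: ts_def distinct_map comp_def lessThan_atLeast0)
    show "\<forall>(a, b) \<in> set ts.
        a \<in> fst (active_graph G X) \<and> b \<in> snd (active_graph G X) \<and> tandem G X a b"
      using memb tan by (auto simp: ts_def)
    show "\<forall>i < length ts. fst (snd (ts ! i)) = fst (fst (ts ! (Suc i mod length ts)))"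
      using Bv fstA n by (auto simp: ts_def)
  qed
  define L where "L = (set (map fst ts), set (map snd ts))"
  have L: "L \<in> generated_rotations G X" using cyc by (auto simp: generated_rotations_def L_def)
  have "block L \<subseteq> upper Y"
  proof
    fix e assume "e \<in> block L"
    then obtain b a where b: "better b e" and a: "a \<in> fst L" "fst a = fst e" "\<not> better a e"
      unfolding block_def by blast
    have eE: "e \<in> E G" using b by (simp add: better_def)
    have au: "a \<in> upper Y" using a(1) setA Au by (auto simp: L_def Q_def)
    then have aE: "a \<in> E G" using upper_subset by blast
    have "\<not> better y e" if y: "y \<in> Y" for y
    proof
      assume ye: "better y e"
      have "\<not> better y a" using au y unfolding upper_def by blast
      moreover have "y \<in> E G" "fst y = fst a" using ye a(2) by (auto simp: better_def)
      ultimately have "y = a \<or> better a y" using better_total aE by blast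
      then show False using ye a(3) better_trans by blast
    qed
    then show "e \<in> upper Y" using eE unfolding upper_def by blast
  qed
  then show ?thesis using that[OF L] upper_apply_rotation[OF X L] sub by blast
qed

text \<open>A rotation of \<open>X\<close> towards \<open>Z\<close> stays inside \<open>block L\<close>, so it shares an edge with \<open>L\<close> and
  therefore equals \<open>L\<close>.\<close>

lemma rotation_covers:
  assumes X: "stable G X" and L: "L \<in> generated_rotations G X" and Z: "stable G Z"
    and XZ: "upper X \<subseteq> upper Z" and ZX': "upper Z \<subseteq> upper (apply_rotation L X)"
  shows "upper Z = upper X \<or> upper Z = upper (apply_rotation L X)"
proof (cases "X = Z")
  case False
  obtain L' where L': "L' \<in> generated_rotations G X" "upper (apply_rotation L' X) \<subseteq> upper Z"
    by (rule rotation_towards[OF X Z XZ False])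
  obtain a' where a': "a' \<in> fst L'" using generated_rotation_facts(1)[OF L'(1)] by blast
  then have a'b: "a' \<in> block L'" using rotation_subset_block[OF X L'(1)] by blast
  then have "a' \<in> block L"
    using L'(2) ZX' block_disjoint[OF X L'(1)] upper_apply_rotation[OF X L'(1)]
      upper_apply_rotation[OF X L] by blast
  then obtain a where a: "a \<in> fst L" "fst a = fst a'" unfolding block_def by blast
  then have "a = a'"
    using W_admissible_unique generated_rotation_facts(2)[OF L] generated_rotation_facts(2)[OF L'(1)] a'
    by blast
  then have "L = L'" using rotation_eq_if_common_edge[OF X L L'(1)] a a' by blast
  then show ?thesis using L' ZX' by blast
qed blast

text \<open>For \<open>X' = apply_rotation L X\<close>, the stable matching \<open>X \<squnion> (X' \<sqinter> Y)\<close> lies between \<open>X\<close> and \<open>X'\<close>,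
  hence is one of the two.\<close>

lemma block_all_or_nothing:
  assumes X: "stable G X" and L: "L \<in> generated_rotations G X" and Y: "stable G Y"
  shows "block L \<subseteq> upper Y \<or> block L \<inter> upper Y = {}"
proof -
  let ?X' = "apply_rotation L X"
  obtain T where T: "stable G T" "upper T = upper ?X' \<inter> upper Y"
    using stable_meet[OF stable_apply_rotation[OF X L] Y] .
  obtain Z where Z: "stable G Z" "upper Z = upper X \<union> upper T" using stable_join[OF X T(1)] .
  have "upper Z = upper X \<or> upper Z = upper ?X'"
    using rotation_covers[OF X L Z(1)] Z(2) T(2) upper_apply_rotation[OF X L] by blast
  then show ?thesis
    using Z(2) T(2) upper_apply_rotation[OF X L] block_disjoint[OF X L] by blast
qed

text \<open>At each vertex \<open>L\<^sup>+\<close> consists of the worst edge of the block and \<open>L\<^sup>-\<close> of the edge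
  immediately above it, so both are recovered from the block alone.\<close>

lemma
  assumes X: "stable G X" and L: "L \<in> generated_rotations G X"
  shows fst_eq_block: "fst L = {a \<in> block L. \<forall>e\<in>block L. \<not> better a e}"
    and snd_eq_block: "snd L = {b. b \<notin> block L \<and> (\<exists>e\<in>block L. better b e \<and>
      (\<forall>b'. better b b' \<and> better b' e \<longrightarrow> b' \<in> block L))}"
proof -
  note facts = generated_rotation_facts[OF L]
  have blockE: "e \<in> E G" if "e \<in> block L" for e using that unfolding block_def better_def by blast
  have PB: "a \<in> block L" if "a \<in> fst L" for a using that rotation_subset_block[OF X L] by blast
  have injP: "a = a'" if "a \<in> fst L" "a' \<in> fst L" "fst a = fst a'" for a a'
    using W_admissible_unique facts(2) that by blast
  show "fst L = {a \<in> block L. \<forall>e\<in>block L. \<not> better a e}"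
  proof (intro set_eqI iffI)
    fix a assume a: "a \<in> fst L"
    have "\<not> better a e" if e: "e \<in> block L" for e
    proof
      assume ae: "better a e"
      obtain a' where a': "a' \<in> fst L" "fst a' = fst e" "\<not> better a' e"
        using e unfolding block_def by blast
      then show False using injP[OF a a'(1)] better_fst[OF ae] ae by simp
    qed
    then show "a \<in> {a \<in> block L. \<forall>e\<in>block L. \<not> better a e}" using PB[OF a] by blast
  next
    fix a assume a: "a \<in> {a \<in> block L. \<forall>e\<in>block L. \<not> better a e}"
    then obtain a' where a': "a' \<in> fst L" "fst a' = fst a" "\<not> better a' a"
      unfolding block_def by blast
    have "\<not> better a a'" using a PB[OF a'(1)] by blast
    then have "a = a'" using better_total[of a a'] a a' blockE PB[OF a'(1)] by auto
    then show "a \<in> fst L" using a' by simp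
  qed
  have between: "b' \<in> block L" if b: "b \<in> snd L" "better b b'" "better b' e" "e \<in> block L" for b b' e
  proof -
    obtain a where a: "a \<in> fst L" "fst a = fst e" "\<not> better a e"
      using b(4) unfolding block_def by blast
    moreover have "fst a = fst b'" using a(2) better_fst[OF b(3)] by simp
    moreover have "\<not> better a b'" using a(3) b(3) better_trans by blast
    ultimately show ?thesis using b(1,2) unfolding block_def by blast
  qed
  have NB: "b \<notin> block L" if "b \<in> snd L" for b
    using that facts(3) stable_subset_upper[OF X] block_disjoint[OF X L] by blast
  show "snd L = {b. b \<notin> block L \<and> (\<exists>e\<in>block L. better b e \<and>
      (\<forall>b'. better b b' \<and> better b' e \<longrightarrow> b' \<in> block L))}" (is "_ = ?R")
  proof (intro set_eqI iffI)
    fix b assume b: "b \<in> snd L"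
    obtain a where a: "a \<in> fst L" "fst a = fst b" using facts(4) b by (metis image_iff)
    obtain b1 where b1: "b1 \<in> snd L" "better b1 a" using PB[OF a(1)] unfolding block_def by blast
    have "b1 = b"
      using inj_onD[OF stable_inj[OF X], of b1 b] b b1 facts(3) better_fst[OF b1(2)] a(2) by auto
    then show "b \<in> ?R" using NB[OF b] PB[OF a(1)] b1 between[OF b] by blast
  next
    fix b assume "b \<in> ?R"
    then obtain e where bB: "b \<notin> block L" and e: "e \<in> block L" "better b e"
      and bet: "\<And>b'. better b b' \<Longrightarrow> better b' e \<Longrightarrow> b' \<in> block L" by blast
    obtain b1 where b1: "b1 \<in> snd L" "better b1 e" using e(1) unfolding block_def by blast
    have "\<not> better b b1" using bet b1(2) NB[OF b1(1)] by blast
    moreover have "\<not> better b1 b" using between[OF b1(1) _ e(2) e(1)] bB by blast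
    ultimately have "b = b1"
      using better_total[of b b1] e(2) b1(2) by (auto simp: better_def)
    then show "b \<in> snd L" using b1 by simp
  qed
qed

definition is_rotation :: "('w, 'f) rotation \<Rightarrow> bool" where
  "is_rotation R \<longleftrightarrow> (\<exists>X. stable G X \<and> R \<in> generated_rotations G X)"

lemma is_rotation_block_nonempty: "is_rotation R \<Longrightarrow> block R \<noteq> {}"
  using rotation_subset_block generated_rotation_facts(1) unfolding is_rotation_def by blast

lemma is_rotation_all_or_nothing:
  "is_rotation R \<Longrightarrow> stable G Y \<Longrightarrow> e \<in> block R \<Longrightarrow> e \<in> upper Y \<Longrightarrow> block R \<subseteq> upper Y"
  using block_all_or_nothing unfolding is_rotation_def by blast

text \<open>The rotations may stem from different stable matchings. Each block is the difference of two
  upper sets, and the other block must lie in the larger and avoid the smaller one.\<close>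

lemma rotation_eq_if_blocks_meet:
  assumes "is_rotation R" "is_rotation R'" "e \<in> block R" "e \<in> block R'"
  shows "R = R'"
proof -
  have aux: "block R \<subseteq> block R'"
    if R: "is_rotation R" "is_rotation R'" "e \<in> block R" "e \<in> block R'" for R R'
  proof -
    obtain X where X: "stable G X" "R' \<in> generated_rotations G X"
      using R(2) unfolding is_rotation_def by blast
    note up = upper_apply_rotation[OF X] and dis = block_disjoint[OF X]
    have "block R \<subseteq> upper (apply_rotation R' X)"
      using is_rotation_all_or_nothing[OF R(1) stable_apply_rotation[OF X] R(3)] R(4) up by blast
    moreover have "block R \<inter> upper X = {}"
      using is_rotation_all_or_nothing[OF R(1) X(1)] R(3,4) dis by blast
    ultimately show ?thesis using up by blast
  qed
  have eq: "block R = block R'" using aux[OF assms] aux[OF assms(2,1,4,3)] by blast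
  obtain X where X: "stable G X" "R \<in> generated_rotations G X"
    using assms(1) unfolding is_rotation_def by blast
  obtain X' where X': "stable G X'" "R' \<in> generated_rotations G X'"
    using assms(2) unfolding is_rotation_def by blast
  show ?thesis
    using fst_eq_block[OF X] snd_eq_block[OF X] fst_eq_block[OF X'] snd_eq_block[OF X'] eq
    by (simp add: prod_eq_iff)
qed

section \<open>Routes\<close>

lemma route_facts:
  assumes "route G X Ls Y"
  shows "stable G X \<and> stable G Y \<and> upper Y = upper X \<union> (\<Union>L\<in>set Ls. block L) \<and>
    distinct Ls \<and> (\<forall>L\<in>set Ls. is_rotation L \<and> block L \<inter> upper X = {})"
  using assms
proof (induction rule: route.induct)
  case (route_snoc Ls Y L)
  have Y: "stable G Y" using route_snoc.IH by blast
  note L = route_snoc.hyps(2)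
  have rot: "is_rotation L" using Y L unfolding is_rotation_def by blast
  have dis: "block L \<inter> upper Y = {}" using block_disjoint[OF Y L] by blast
  then have "L \<notin> set Ls" using is_rotation_block_nonempty[OF rot] route_snoc.IH by blast
  then show ?case
    using route_snoc.IH stable_apply_rotation[OF Y L] upper_apply_rotation[OF Y L] rot dis by auto
qed simp

lemma route_append:
  assumes "route G Y Ms Z" "route G X Ls Y"
  shows "route G X (Ls @ Ms) Z"
  using assms
proof (induction rule: route.induct)
  case (route_snoc Ms Z L)
  then show ?case using route.route_snoc[of G X "Ls @ Ms" Z L] by simp
qed simp

lemma route_prefix: "route G X (Ls @ Ms) Y \<Longrightarrow> \<exists>Z. route G X Ls Z"
proof (induction Ms arbitrary: Y rule: rev_induct)
  case (snoc L Ms)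
  from snoc.prems have "\<exists>Z. route G X (Ls @ Ms) Z"
    by (cases rule: route.cases) (auto simp flip: append_assoc)
  then show ?case using snoc.IH by blast
qed auto

text \<open>Of the matchings reachable without leaving \<open>upper Y\<close>, the one closest to \<open>Y\<close> must be \<open>Y\<close>.\<close>

lemma route_exists:
  assumes X: "stable G X" and Y: "stable G Y" and sub: "upper X \<subseteq> upper Y"
  shows "\<exists>Ls. route G X Ls Y"
proof -
  let ?reach = "\<lambda>Z. upper Z \<subseteq> upper Y \<and> (\<exists>Ls. route G X Ls Z)"
  have "?reach X" using sub route_Nil[OF X] by blast
  then obtain Z where Z: "?reach Z"
    and least: "\<And>Z'. ?reach Z' \<Longrightarrow> card (upper Y - upper Z) \<le> card (upper Y - upper Z')"
    using ex_has_least_nat[of ?reach X "\<lambda>Z. card (upper Y - upper Z)"] by blast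
  obtain Ls where Ls: "route G X Ls Z" using Z by blast
  have stZ: "stable G Z" using route_facts[OF Ls] by blast
  have "Z = Y"
  proof (rule ccontr)
    assume "Z \<noteq> Y"
    then obtain L where L: "L \<in> generated_rotations G Z" "upper (apply_rotation L Z) \<subseteq> upper Y"
      using rotation_towards[OF stZ Y] Z by blast
    have "is_rotation L" using stZ L unfolding is_rotation_def by blast
    then have "upper Y - upper (apply_rotation L Z) \<subset> upper Y - upper Z"
      using is_rotation_block_nonempty block_disjoint[OF stZ L(1)] upper_apply_rotation[OF stZ L(1)] L(2)
      by blast
    moreover have "finite (upper Y - upper Z)"
      using upper_subset finite_E by (meson finite_Diff finite_subset)
    ultimately have "card (upper Y - upper (apply_rotation L Z)) < card (upper Y - upper Z)"
      using psubset_card_mono by blast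
    then show False using least[of "apply_rotation L Z"] L(2) route_snoc[OF Ls L(1)] by (meson not_le)
  qed
  then show ?thesis using Ls by blast
qed

lemma in_route_iff:
  assumes r: "route G X Ls Y" and R: "is_rotation R"
  shows "R \<in> set Ls \<longleftrightarrow> block R \<subseteq> upper Y \<and> block R \<inter> upper X = {}"
proof
  show "R \<in> set Ls \<Longrightarrow> block R \<subseteq> upper Y \<and> block R \<inter> upper X = {}"
    using route_facts[OF r] by blast
next
  assume *: "block R \<subseteq> upper Y \<and> block R \<inter> upper X = {}"
  obtain e where e: "e \<in> block R" using is_rotation_block_nonempty[OF R] by blast
  then obtain L where "L \<in> set Ls" "e \<in> block L" using * route_facts[OF r] by blast
  then show "R \<in> set Ls" using rotation_eq_if_blocks_meet[OF R _ e] route_facts[OF r] by blast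
qed

lemma indicator_apply_rotation:
  assumes "stable G X" "L \<in> generated_rotations G X"
  shows "indicator (apply_rotation L X) e = indicator X e + A_matrix e L"
  using rotation_fresh[OF assms] generated_rotation_facts(3)[OF assms(2)]
  by (auto simp: apply_rotation_def A_matrix_def indicator_def)

lemma indicator_route:
  assumes "route G X Ls Y"
  shows "indicator Y e = indicator X e + (\<Sum>L\<in>set Ls. A_matrix e L)"
  using assms
proof (induction rule: route.induct)
  case (route_snoc Ls Y L)
  have "distinct (Ls @ [L])" using route_facts[OF route.route_snoc[OF route_snoc.hyps]] by blast
  moreover have "stable G Y" using route_facts[OF route_snoc.hyps(1)] by blast
  ultimately show ?case using route_snoc.IH indicator_apply_rotation[OF _ route_snoc.hyps(2)] by simp
qed simp

section \<open>Ideals of rotations\<close>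

lemma least_stable_above:
  assumes "stable G Y" "A \<subseteq> upper Y"
  shows "\<exists>J. stable G J \<and> A \<subseteq> upper J \<and>
    (\<forall>Z. stable G Z \<longrightarrow> A \<subseteq> upper Z \<longrightarrow> upper J \<subseteq> upper Z)"
proof -
  let ?P = "\<lambda>J. stable G J \<and> A \<subseteq> upper J"
  obtain J where J: "?P J" and least: "\<And>Z. ?P Z \<Longrightarrow> card (upper J) \<le> card (upper Z)"
    using ex_has_least_nat[of ?P Y "\<lambda>J. card (upper J)"] assms by blast
  have "upper J \<subseteq> upper Z" if Z: "?P Z" for Z
  proof -
    obtain T where T: "stable G T" "upper T = upper J \<inter> upper Z"
      using stable_meet[of J Z] J Z by blast
    then have "card (upper J) \<le> card (upper T)" using least J Z by blast
    moreover have "finite (upper J)" using upper_subset finite_E finite_subset by blast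
    ultimately have "upper T = upper J" using card_seteq T(2) by (metis inf_le1)
    then show ?thesis using T(2) by blast
  qed
  then show ?thesis using J by (intro exI[of _ J] conjI allI impI) simp_all
qed

lemma greatest_stable: "\<exists>X. stable G X \<and> (\<forall>Y. stable G Y \<longrightarrow> upper Y \<subseteq> upper X)"
proof -
  have fin: "finite (upper Z)" for Z using upper_subset finite_E finite_subset by blast
  obtain X0 where "stable G X0" using stable_exists by blast
  moreover have "\<forall>Y. stable G Y \<longrightarrow> card (upper Y) < Suc (card (E G))"
    using card_mono[OF finite_E upper_subset] by (auto simp: less_Suc_eq_le)
  ultimately obtain X where X: "stable G X" "\<forall>Y. stable G Y \<longrightarrow> card (upper Y) \<le> card (upper X)"
    using ex_has_greatest_nat[of "stable G" X0 "\<lambda>X. card (upper X)" "Suc (card (E G))"] by blast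
  have "upper Y \<subseteq> upper X" if Y: "stable G Y" for Y
  proof -
    obtain T where T: "stable G T" "upper T = upper X \<union> upper Y" using stable_join[OF X(1) Y] .
    then have "upper X = upper T" using X(2) card_seteq[OF fin] by (metis Un_upper1)
    then show ?thesis using T(2) by blast
  qed
  then show ?thesis using X(1) by blast
qed

lemma succ_F_if_upper_subset:
  assumes X: "stable G X" and Y: "stable G Y" and sub: "upper X \<subseteq> upper Y" and "X \<noteq> Y"
  shows "succ_F G Y X"
proof -
  have ch: "chosen (Y \<union> X) = Y"
    using stable_chosen_between[OF Y, of "Y \<union> X"] stable_subset_upper[OF X] stable_subset_upper[OF Y] sub
    by blast
  have YXE: "Y \<union> X \<subseteq> E G" using stable_subset[OF X] stable_subset[OF Y] by blast
  have "choiceF G f (atF Y f \<union> atF X f) = atF Y f" if "f \<in> FV G" for f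
  proof -
    have "atF (Y \<union> X) f = atF Y f \<union> atF X f" by (auto simp: atF_def)
    then show ?thesis using atF_chosen[OF YXE that] ch by simp
  qed
  then show ?thesis using assms by (auto simp: succ_F_def stable_def)
qed

lemma succ_F_asym:
  assumes "succ_F G X Y" "succ_F G Y X"
  shows False
proof -
  have "atF X f = atF Y f" if "f \<in> FV G" for f
    using assms that unfolding succ_F_def by (metis Un_commute)
  then have "X = Y"
    using assms eq_if_atF_eq[of X Y] by (simp add: succ_F_def acceptable_def)
  then show False using assms by (simp add: succ_F_def)
qed

lemma X_min: "stable G (X_min G)" "stable G Y \<Longrightarrow> upper (X_min G) \<subseteq> upper Y"
proof -
  obtain X0 where "stable G X0" using stable_exists by blast
  from least_stable_above[OF this empty_subsetI]
  obtain X where X: "stable G X" "\<And>Z. stable G Z \<Longrightarrow> upper X \<subseteq> upper Z" by auto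
  have "X_min G = X"
    unfolding X_min_def
  proof (rule the_equality)
    show "X \<in> stable_matchings G \<and> (\<forall>Y \<in> stable_matchings G. Y \<noteq> X \<longrightarrow> succ_F G Y X)"
      using X succ_F_if_upper_subset unfolding stable_matchings_def by blast
    then show "Z \<in> stable_matchings G \<and> (\<forall>Y \<in> stable_matchings G. Y \<noteq> Z \<longrightarrow> succ_F G Y Z) \<Longrightarrow> Z = X" for Z
      using succ_F_asym by metis
  qed
  then show "stable G (X_min G)" "stable G Y \<Longrightarrow> upper (X_min G) \<subseteq> upper Y" using X by simp_all
qed

lemma X_max: "stable G (X_max G)" "stable G Y \<Longrightarrow> upper Y \<subseteq> upper (X_max G)"
proof -
  obtain X where X: "stable G X" "\<And>Z. stable G Z \<Longrightarrow> upper Z \<subseteq> upper X"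
    using greatest_stable by blast
  have "X_max G = X"
    unfolding X_max_def
  proof (rule the_equality)
    show "X \<in> stable_matchings G \<and> (\<forall>Y \<in> stable_matchings G. Y \<noteq> X \<longrightarrow> succ_F G X Y)"
      using X succ_F_if_upper_subset unfolding stable_matchings_def by blast
    then show "Z \<in> stable_matchings G \<and> (\<forall>Y \<in> stable_matchings G. Y \<noteq> Z \<longrightarrow> succ_F G Z Y) \<Longrightarrow> Z = X" for Z
      using succ_F_asym by metis
  qed
  then show "stable G (X_max G)" "stable G Y \<Longrightarrow> upper Y \<subseteq> upper (X_max G)" using X by simp_all
qed

definition passed :: "('w, 'f) edge set \<Rightarrow> ('w, 'f) rotation set" where
  "passed X = {R. is_rotation R \<and> block R \<subseteq> upper X}"

lemma set_route_from_min:
  assumes "route G (X_min G) Ls X"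
  shows "set Ls = passed X"
proof -
  have dis: "block R \<inter> upper (X_min G) = {}" if R: "is_rotation R" for R
  proof -
    obtain Z where Z: "stable G Z" "R \<in> generated_rotations G Z"
      using R unfolding is_rotation_def by blast
    then show ?thesis using block_disjoint[OF Z] X_min(2)[OF Z(1)] by blast
  qed
  have rot: "is_rotation R" if "R \<in> set Ls" for R using route_facts[OF assms] that by simp
  show ?thesis
  proof (intro set_eqI iffI)
    fix R assume R: "R \<in> set Ls"
    show "R \<in> passed X" using in_route_iff[OF assms rot[OF R]] rot[OF R] R by (simp add: passed_def)
  next
    fix R assume "R \<in> passed X"
    then have "is_rotation R" "block R \<subseteq> upper X" by (simp_all add: passed_def)
    then show "R \<in> set Ls" using in_route_iff[OF assms] dis by simp
  qed
qed

lemma full_route_through: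
  assumes "stable G X"
  obtains Ls Ms where "route G (X_min G) Ls X" "full_route G (Ls @ Ms)"
proof -
  obtain Ls where Ls: "route G (X_min G) Ls X" 
    using route_exists[OF X_min(1) assms X_min(2)[OF assms]] by blast
  obtain Ms where Ms: "route G X Ms (X_max G)" 
    using route_exists[OF assms X_max(1) X_max(2)[OF assms]] by blast
  show ?thesis using route_append[OF Ms Ls] by (intro that[OF Ls]) (simp add: full_route_def)
qed

lemma passed_max: "passed (X_max G) = {R. is_rotation R}"
proof -
  have "block R \<subseteq> upper (X_max G)" if R: "is_rotation R" for R
  proof -
    obtain Z where Z: "stable G Z" "R \<in> generated_rotations G Z" using R unfolding is_rotation_def by blast
    then show ?thesis
      using upper_apply_rotation[OF Z] X_max(2)[OF stable_apply_rotation[OF Z]] by blast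
  qed
  then show ?thesis unfolding passed_def by blast
qed

lemma set_full_route: "full_route G Ls \<Longrightarrow> set Ls = {R. is_rotation R}"
  using set_route_from_min[of Ls "X_max G"] passed_max by (simp add: full_route_def)

lemma full_route_exists: "\<exists>Ls. full_route G Ls"
proof -
  obtain Ls Ms where "full_route G (Ls @ Ms)" by (rule full_route_through[OF X_min(1)])
  then show ?thesis ..
qed

lemma rotations_eq: "rotations G = {R. is_rotation R}"
  using set_full_route full_route_exists unfolding rotations_def by auto

lemma finite_rotations: "finite (rotations G)"
proof -
  obtain Ls where "full_route G Ls" using full_route_exists ..
  then show ?thesis using set_full_route[of Ls] finite_set[of Ls] by (simp add: rotations_eq)
qed

lemma gamma_passed:
  assumes X: "stable G X"
  shows "gamma G (char_vec (rotations G) (passed X)) = char_vec (E G) X"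
proof
  fix e
  obtain Ls where Ls: "route G (X_min G) Ls X" by (rule full_route_through[OF X])
  have sub: "passed X \<subseteq> rotations G" unfolding rotations_eq passed_def by blast
  have "(\<Sum>R\<in>rotations G. A_matrix e R * char_vec (rotations G) (passed X) R) =
      (\<Sum>R\<in>rotations G. if R \<in> passed X then A_matrix e R else 0)"
    by (rule sum.cong) (auto simp: char_vec_def)
  also have "\<dots> = (\<Sum>R\<in>passed X. A_matrix e R)"
    using finite_rotations sub by (simp add: sum.If_cases Int_absorb1)
  finally show "gamma G (char_vec (rotations G) (passed X)) e = char_vec (E G) X e"
    using indicator_route[OF Ls, of e] set_route_from_min[OF Ls]
    by (simp add: gamma_def char_vec_def)
qed

text \<open>A full route through \<open>X\<close> has the rotations passed by \<open>X\<close> as an initial segment.\<close>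

lemma passed_ideal:
  assumes X: "stable G X"
  shows "rot_ideal G (passed X)"
proof -
  obtain Ls Ms where Ls: "route G (X_min G) Ls X" and full: "full_route G (Ls @ Ms)"
    using full_route_through[OF X] .
  have d: "distinct (Ls @ Ms)" using route_facts full unfolding full_route_def by metis
  have "R \<in> set Ls" if R: "rot_less G R R'" "R' \<in> set Ls" for R R'
  proof -
    obtain i j where ij: "i < j" "j < length (Ls @ Ms)" "(Ls @ Ms) ! i = R" "(Ls @ Ms) ! j = R'"
      using R(1) full unfolding rot_less_def by blast
    obtain k where k: "k < length Ls" "Ls ! k = R'" using R(2) by (auto simp: in_set_conv_nth)
    then have "(Ls @ Ms) ! k = R'" by (simp add: nth_append)
    then have "j = k" using d ij k nth_eq_iff_index_eq[of "Ls @ Ms" j k] by simp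
    then show ?thesis using ij k by (auto simp: nth_append)
  qed
  then show ?thesis
    unfolding rot_ideal_def set_route_from_min[OF Ls, symmetric]
    using route_facts[OF Ls] rotations_eq by blast
qed

text \<open>The hypothesis on \<open>Z\<close> is applied to the matching reached by a full route right after \<open>R'\<close>.\<close>

lemma rot_lessI:
  assumes R: "is_rotation R" "is_rotation R'" "R \<noteq> R'"
    and dep: "\<And>Z. stable G Z \<Longrightarrow> block R' \<subseteq> upper Z \<Longrightarrow> block R \<subseteq> upper Z"
  shows "rot_less G R R'"
  unfolding rot_less_def
proof (intro conjI allI impI)
  show "R \<in> rotations G" "R' \<in> rotations G" using R rotations_eq by blast+
  fix Ls assume full: "full_route G Ls"
  then have "R' \<in> set Ls" using set_full_route R by blast
  then obtain Ms Ns where Ls: "Ls = Ms @ R' # Ns" by (meson split_list)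
  then have "route G (X_min G) ((Ms @ [R']) @ Ns) (X_max G)" using full unfolding full_route_def by simp
  then obtain Z where Z: "route G (X_min G) (Ms @ [R']) Z" using route_prefix by blast
  have "R' \<in> passed Z" using set_route_from_min[OF Z] by auto
  then have "R \<in> passed Z" using dep R(1) route_facts[OF Z] unfolding passed_def by blast
  then have "R \<in> set Ms" using set_route_from_min[OF Z] R(3) by auto
  then obtain i where "i < length Ms" "Ms ! i = R" by (auto simp: in_set_conv_nth)
  then show "\<exists>i j. i < j \<and> j < length Ls \<and> Ls ! i = R \<and> Ls ! j = R'"
    unfolding Ls by (intro exI[of _ i] exI[of _ "length Ms"]) (auto simp: nth_append)
qed

text \<open>Take a stable matching passing only rotations of \<open>I\<close>, as far from \<open>X_min G\<close> as possible. If it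
  missed some \<open>R \<in> I\<close>, one could join it with the least stable matching \<open>J\<close> that passes \<open>R\<close>:
  everything passed by \<open>J\<close> other than \<open>R\<close> precedes \<open>R\<close>, hence lies in the ideal.\<close>

lemma ideal_is_passed:
  assumes I: "rot_ideal G I"
  obtains X where "stable G X" "I = passed X"
proof -
  let ?P = "\<lambda>X. stable G X \<and> passed X \<subseteq> I"
  have "route G (X_min G) [] (X_min G)" using route_Nil X_min(1) by blast
  then have "passed (X_min G) = {}" using set_route_from_min by fastforce
  then have "?P (X_min G)" using X_min(1) by blast
  moreover have "\<forall>X. ?P X \<longrightarrow> card (upper X) < Suc (card (E G))"
    using card_mono[OF finite_E upper_subset] by (auto simp: less_Suc_eq_le)
  ultimately obtain X where X: "?P X" and great: "\<forall>Y. ?P Y \<longrightarrow> card (upper Y) \<le> card (upper X)"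
    using ex_has_greatest_nat[of ?P "X_min G" "\<lambda>X. card (upper X)" "Suc (card (E G))"] by blast
  have "R \<in> passed X" if RI: "R \<in> I" for R
  proof (rule ccontr)
    assume RX: "R \<notin> passed X"
    have R: "is_rotation R" using RI I rotations_eq unfolding rot_ideal_def by blast
    have "R \<in> passed (X_max G)" using R passed_max by blast
    then have "block R \<subseteq> upper (X_max G)" unfolding passed_def by blast
    from least_stable_above[OF X_max(1) this]
    obtain J where J: "stable G J" "block R \<subseteq> upper J"
      "\<And>Z. stable G Z \<Longrightarrow> block R \<subseteq> upper Z \<Longrightarrow> upper J \<subseteq> upper Z" by auto
    have "stable G X" using X by blast
    then obtain Y where Y: "stable G Y" "upper Y = upper X \<union> upper J" using stable_join J(1) by metis
    have "R' \<in> I" if R': "R' \<in> passed Y" for R'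
    proof -
      have rot: "is_rotation R'" and "block R' \<subseteq> upper X \<union> upper J"
        using R' Y(2) unfolding passed_def by auto
      then obtain e where e: "e \<in> block R'" "e \<in> upper X \<or> e \<in> upper J"
        using is_rotation_block_nonempty[OF rot] by blast
      from e(2) show ?thesis
      proof
        assume "e \<in> upper X"
        then have "R' \<in> passed X"
          using is_rotation_all_or_nothing[OF rot _ e(1)] X rot unfolding passed_def by blast
        then show ?thesis using X by blast
      next
        assume "e \<in> upper J"
        then have RJ: "block R' \<subseteq> upper J" using is_rotation_all_or_nothing[OF rot J(1) e(1)] by blast
        show ?thesis
        proof (cases "R' = R")
          case False
          then have "rot_less G R' R" using rot_lessI[OF rot R] J(3) RJ by blast
          then show ?thesis using I RI unfolding rot_ideal_def by blast
        qed (use RI in simp)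
      qed
    qed
    then have "card (upper Y) \<le> card (upper X)" using great Y(1) by blast
    moreover have "finite (upper Y)" using upper_subset finite_E finite_subset by blast
    ultimately have "upper X = upper Y" using card_seteq[of "upper Y" "upper X"] Y(2) by blast
    then show False using RX R J(2) Y(2) unfolding passed_def by blast
  qed
  then show ?thesis using that X by blast
qed

lemma char_vec_inject: "X \<subseteq> U \<Longrightarrow> Y \<subseteq> U \<Longrightarrow> char_vec U X = char_vec U Y \<Longrightarrow> X = Y"
proof -
  assume sub: "X \<subseteq> U" "Y \<subseteq> U" and eq: "char_vec U X = char_vec U Y"
  have "u \<in> X \<longleftrightarrow> u \<in> Y" if "u \<in> U" for u
    using fun_cong[OF eq, of u] that by (simp add: char_vec_def indicator_def of_bool_eq_iff)
  then show "X = Y" using sub by blast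
qed

end

theorem mainTheorem6:
  fixes G :: "('w, 'f) market"
  assumes "choice_market G"
  shows "bij_betw (gamma G)
           {char_vec (rotations G) I | I. rot_ideal G I}
           {char_vec (E G) X | X. X \<in> stable_matchings G}"
proof -
  interpret choice_market G by fact
  have ideals: "{char_vec (rotations G) I | I. rot_ideal G I} =
      (\<lambda>X. char_vec (rotations G) (passed X)) ` {X. stable G X}"
  proof (intro set_eqI iffI)
    fix x assume "x \<in> {char_vec (rotations G) I | I. rot_ideal G I}"
    then obtain I where I: "x = char_vec (rotations G) I" "rot_ideal G I" by blast
    from I(2) obtain X where "stable G X" "I = passed X" by (rule ideal_is_passed)
    then show "x \<in> (\<lambda>X. char_vec (rotations G) (passed X)) ` {X. stable G X}" using I(1) by blast
  next
    fix x assume "x \<in> (\<lambda>X. char_vec (rotations G) (passed X)) ` {X. stable G X}"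
    then show "x \<in> {char_vec (rotations G) I | I. rot_ideal G I}" using passed_ideal by blast
  qed
  have stables: "{char_vec (E G) X | X. X \<in> stable_matchings G} = char_vec (E G) ` {X. stable G X}"
    by (auto simp: stable_matchings_def)
  show ?thesis
    unfolding bij_betw_def ideals stables
  proof
    show "inj_on (gamma G) ((\<lambda>X. char_vec (rotations G) (passed X)) ` {X. stable G X})"
    proof (rule inj_onI, clarify)
      fix X Y assume X: "stable G X" and Y: "stable G Y" and
        "gamma G (char_vec (rotations G) (passed X)) = gamma G (char_vec (rotations G) (passed Y))"
      then have "char_vec (E G) X = char_vec (E G) Y" using gamma_passed[OF X] gamma_passed[OF Y] by simp
      then have "X = Y" using char_vec_inject[OF stable_subset[OF X] stable_subset[OF Y]] by blast
      then show "char_vec (rotations G) (passed X) = char_vec (rotations G) (passed Y)" by simp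
    qed
    show "gamma G ` (\<lambda>X. char_vec (rotations G) (passed X)) ` {X. stable G X} =
        char_vec (E G) ` {X. stable G X}"
      unfolding image_image using gamma_passed by (intro image_cong) auto
  qed
qed

end
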